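(* Let $\mathcal H$ be a complex Hilbert space of finite dimension $N$, let $A=A^\ast$ be an operator on $\mathcal H$, let $B$ be a sectorial operator on $\mathcal H$ with sectorial constants $\sigma_1,\sigma_2$ and let $M=\operatorname{rank}(B)$. For $\gamma\in\mathbb C$ put $A_\gamma=A+\gamma B$. Assume that: (a) $B$ is cyclic for $A$; (b) all eigenvalues of $A$ have algebraic multiplicity $1$; (c) all non-zero eigenvalues of $B$ have algebraic multiplicity $1$; (d) all eigenvalues of the truncation $A^\natural$ of $A$ to $\operatorname{Ker}(B)$ have algebraic multiplicity $1$. Let $F\subset S_B$ be the finite exceptional set defined in the context, and let $g:[0,\infty)\to\mathbb C$ be a continuously differentiable curve such that $g(0)=0$, $g(t)\in S_B\setminus F$ and $g(t)\neq 0$ for every $t>0$, $g'(t)\neq 0$ for every $t\in[0,\infty)$, and $\lim_{t\to\infty}|g(t)|=\infty$. Then there exist $N$ continuously differentiable curves $\lambda_1,\dots,\lambda_N:[0,\infty)\to\mathbb C$, with $\lambda_r(t)\in\mathbb C_+$ for all $t>0$ and $\lambda_r'(t)\ne 0$ for all $t\geq 0$, such that $$\operatorname{Spec}(A_{g(t)})=\{\lambda_1(t),\dots,\lambda_N(t)\}\quad\text{for all } t\in[0,\infty).$$ One can choose the ordering of these curves so that $\lambda_r(0)=\alpha_r$ for all $r\in\{1,\dots,N\}$, where $\alpha_1,\dots,\alpha_N$ are the eigenvalues of $A$ written in increasing order. Assuming this is done, there exists a permutation $\pi$ of $\{1,\dots,N\}$ (depending on $g$) such that $$\lim_{t\to\infty}\frac{\lambda_{\pi(r)}(t)}{g(t)}=\beta_r\quad\text{for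 } 1\le r\le M,$$ where $\beta_1,\dots,\beta_M$ are the non-zero eigenvalues of $B$ written in any fixed order, and $$\lim_{t\to\infty}\lambda_{\pi(M+r)}(t)=\delta_r\quad\text{for }1\le r\le N-M,$$ where $\delta_1,\dots,\delta_{N-M}$ are the eigenvalues of $A^\natural$ written in increasing order. If in addition $g$ is a real analytic curve then so are all the curves $\lambda_r$.
   Context: $\mathbb C_+=\{z\in\mathbb C:\operatorname{Im}(z)>0\}$. A bounded operator $B$ on $\mathcal H$ is sectorial with sectorial constants $\sigma_1,\sigma_2$, where $-\pi/2<-\sigma_1\le 0\le\sigma_2<\pi/2$, if $\{\langle Bf,f\rangle:f\in\mathcal H\}\subseteq\{0\}\cup\{z\neq 0:-\sigma_1\le\arg(z)\le\sigma_2\}$. For such $B$, $S_B=\{0\}\cup\{\gamma\in\mathbb C:\gamma\ne0,\ \sigma_1<\arg(\gamma)<\pi-\sigma_2\}$. $B$ is cyclic for $A$ (finite-dimensional case) if the linear span of $\{A^nBv: n=0,1,2,\dots,\ v\in\mathcal H\}$ is $\mathcal H$. The truncation of an operator $A$ to a subspace $\mathcal K$ is $PA P|_{\mathcal K}$, where $P$ is the orthogonal projection onto $\mathcal K$. Exceptional set: let $p(\gamma,\lambda)=\det(A+\gamma B-\lambda I)$. Let $F_1$ be the set of $\gamma\in S_B$ for which the discriminant of the polynomial $\lambda\mapsto p(\gamma,\lambda)$ vanishes (i.e. $A_\gamma$ has an eigenvalue of algebraic multiplicity greater than $1$). Let $F_2$ be the set of $\gamma\in S_B$ for which there is $\lambda\in\mathbb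 C_+$ with $p(\gamma,\lambda)=0$ such that the polynomial $s\mapsto p(s,\lambda)$ (which has degree $M$ in $s$ for $\lambda\in\mathbb C_+$) does not have $M$ distinct roots in $\mathbb C$. Put $F=F_1\cup F_2$. *)

theory Defs
  imports
    "HOL-Analysis.Analysis"
    "HOL-Combinatorics.Permutations"
    "Jordan_Normal_Form.Char_Poly"
    "Subresultants.Resultant_Prelim"
begin

section \<open>Finite-dimensional complex Hilbert spaces\<close>

text \<open>The inner product is linear in its first argument. For a finite-dimensional space,
  completeness and the boundedness of linear operators are automatic.\<close>

class complex_inner_space = ab_group_add +
  fixes scaleC :: "complex \<Rightarrow> 'a \<Rightarrow> 'a"  (infixr \<open>*\<^sub>C\<close> 75)
    and cinner :: "'a \<Rightarrow> 'a \<Rightarrow> complex"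
  assumes scaleC_add_right: "c *\<^sub>C (x + y) = c *\<^sub>C x + c *\<^sub>C y"
    and scaleC_add_left: "(c + d) *\<^sub>C x = c *\<^sub>C x + d *\<^sub>C x"
    and scaleC_scaleC: "c *\<^sub>C d *\<^sub>C x = (c * d) *\<^sub>C x"
    and scaleC_one: "1 *\<^sub>C x = x"
    and cinner_add_left: "cinner (x + y) z = cinner x z + cinner y z"
    and cinner_scaleC_left: "cinner (c *\<^sub>C x) y = c * cinner x y"
    and cinner_commute: "cinner y x = cnj (cinner x y)"
    and cinner_pos: "x \<noteq> 0 \<Longrightarrow> 0 < Re (cinner x x)"

global_interpretation cvec: vector_space "scaleC :: complex \<Rightarrow> 'a \<Rightarrow> 'a::complex_inner_space"
  by unfold_locales
    (simp_all add: scaleC_add_right scaleC_add_left scaleC_scaleC scaleC_one)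

abbreviation clinear :: "('a::complex_inner_space \<Rightarrow> 'a) \<Rightarrow> bool" where
  "clinear T \<equiv> Vector_Spaces.linear scaleC scaleC T"

definition self_adjoint :: "('a::complex_inner_space \<Rightarrow> 'a) \<Rightarrow> bool" where
  "self_adjoint T \<longleftrightarrow> clinear T \<and> (\<forall>x y. cinner (T x) y = cinner x (T y))"

definition crank :: "('a::complex_inner_space \<Rightarrow> 'a) \<Rightarrow> nat" where
  "crank T = cvec.dim (range T)"

definition Ker :: "('a::complex_inner_space \<Rightarrow> 'a) \<Rightarrow> 'a set" where
  "Ker T = {x. T x = 0}"

definition orth_proj :: "'a::complex_inner_space set \<Rightarrow> 'a \<Rightarrow> 'a" where
  "orth_proj K x = (THE y. y \<in> K \<and> (\<forall>z\<in>K. cinner (x - y) z = 0))"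

definition truncation :: "'a::complex_inner_space set \<Rightarrow> ('a \<Rightarrow> 'a) \<Rightarrow> 'a \<Rightarrow> 'a" where
  "truncation K T x = orth_proj K (T (orth_proj K x))"


section \<open>Spectra, determinants and multiplicities of operators\<close>

text \<open>In the following, \<open>T\<close> is regarded as an operator on the subspace \<open>K\<close>, which it maps
  into itself. Determinants and characteristic polynomials are those of the matrix of \<open>T\<close>
  in an arbitrary basis of \<open>K\<close>; they do not depend on the basis.\<close>

definition spec_on :: "'a::complex_inner_space set \<Rightarrow> ('a \<Rightarrow> 'a) \<Rightarrow> complex set" where
  "spec_on K T = {l. \<exists>v\<in>K. v \<noteq> 0 \<and> T v = l *\<^sub>C v}"

definition basis_list :: "'a::complex_inner_space set \<Rightarrow> 'a list" where
  "basis_list K = (SOME vs. distinct vs \<and> cvec.independent (set vs) \<and> cvec.span (set vs) = K)"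

definition op_matrix :: "'a::complex_inner_space set \<Rightarrow> ('a \<Rightarrow> 'a) \<Rightarrow> complex mat" where
  "op_matrix K T = (let vs = basis_list K; n = length vs in
     Matrix.mat n n (\<lambda>(i, j). cvec.representation (set vs) (T (vs ! j)) (vs ! i)))"

definition op_det :: "('a::complex_inner_space \<Rightarrow> 'a) \<Rightarrow> complex" where
  "op_det T = Determinant.det (op_matrix UNIV T)"

definition alg_mult_on :: "'a::complex_inner_space set \<Rightarrow> ('a \<Rightarrow> 'a) \<Rightarrow> complex \<Rightarrow> nat" where
  "alg_mult_on K T l = Polynomial.order l (char_poly (op_matrix K T))"

abbreviation "Spec T \<equiv> spec_on UNIV T"

abbreviation "alg_mult T l \<equiv> alg_mult_on UNIV T l"

text \<open>The real eigenvalues in increasing order; for a self-adjoint operator these are all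
  eigenvalues. Each occurs once in the list, irrespective of multiplicity.\<close>

definition eigenvalues_increasing :: "'a::complex_inner_space set \<Rightarrow> ('a \<Rightarrow> 'a) \<Rightarrow> real list" where
  "eigenvalues_increasing K T = sorted_list_of_set {x. complex_of_real x \<in> spec_on K T}"

definition cyclic_for :: "('a::complex_inner_space \<Rightarrow> 'a) \<Rightarrow> ('a \<Rightarrow> 'a) \<Rightarrow> bool" where
  "cyclic_for B A \<longleftrightarrow> cvec.span {(A ^^ n) (B v) | n v. True} = UNIV"


section \<open>Sectorial operators and the exceptional set\<close>

definition sectorial :: "('a::complex_inner_space \<Rightarrow> 'a) \<Rightarrow> real \<Rightarrow> real \<Rightarrow> bool" where
  "sectorial B \<sigma>\<^sub>1 \<sigma>\<^sub>2 \<longleftrightarrow> clinear B \<and> - pi / 2 < - \<sigma>\<^sub>1 \<and> - \<sigma>\<^sub>1 \<le> 0 \<and> 0 \<le> \<sigma>\<^sub>2 \<and> \<sigma>\<^sub>2 < pi / 2 \<and>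
     {cinner (B f) f | f. True} \<subseteq> {0} \<union> {z. z \<noteq> 0 \<and> - \<sigma>\<^sub>1 \<le> Arg z \<and> Arg z \<le> \<sigma>\<^sub>2}"

definition sector :: "real \<Rightarrow> real \<Rightarrow> complex set" where
  "sector \<sigma>\<^sub>1 \<sigma>\<^sub>2 = {0} \<union> {\<gamma>. \<gamma> \<noteq> 0 \<and> \<sigma>\<^sub>1 < Arg \<gamma> \<and> Arg \<gamma> < pi - \<sigma>\<^sub>2}"

definition perturbed ::
    "('a::complex_inner_space \<Rightarrow> 'a) \<Rightarrow> ('a \<Rightarrow> 'a) \<Rightarrow> complex \<Rightarrow> 'a \<Rightarrow> 'a" where
  "perturbed A B \<gamma> = (\<lambda>v. A v + \<gamma> *\<^sub>C B v)"

definition pencil_det ::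
    "('a::complex_inner_space \<Rightarrow> 'a) \<Rightarrow> ('a \<Rightarrow> 'a) \<Rightarrow> complex \<Rightarrow> complex \<Rightarrow> complex" where
  "pencil_det A B \<gamma> l = op_det (\<lambda>v. perturbed A B \<gamma> v - l *\<^sub>C v)"

definition discriminant :: "complex poly \<Rightarrow> complex" where
  "discriminant q =
     (-1) ^ (degree q * (degree q - 1) div 2) * resultant q (pderiv q) / lead_coeff q"

definition exceptional1 ::
    "('a::complex_inner_space \<Rightarrow> 'a) \<Rightarrow> ('a \<Rightarrow> 'a) \<Rightarrow> real \<Rightarrow> real \<Rightarrow> complex set" where
  "exceptional1 A B \<sigma>\<^sub>1 \<sigma>\<^sub>2 = {\<gamma> \<in> sector \<sigma>\<^sub>1 \<sigma>\<^sub>2.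
     \<exists>q. (\<forall>l. poly q l = pencil_det A B \<gamma> l) \<and> discriminant q = 0}"

definition exceptional2 ::
    "('a::complex_inner_space \<Rightarrow> 'a) \<Rightarrow> ('a \<Rightarrow> 'a) \<Rightarrow> real \<Rightarrow> real \<Rightarrow> complex set" where
  "exceptional2 A B \<sigma>\<^sub>1 \<sigma>\<^sub>2 = {\<gamma> \<in> sector \<sigma>\<^sub>1 \<sigma>\<^sub>2.
     \<exists>l. Im l > 0 \<and> pencil_det A B \<gamma> l = 0 \<and> card {s. pencil_det A B s l = 0} \<noteq> crank B}"

definition exceptional ::
    "('a::complex_inner_space \<Rightarrow> 'a) \<Rightarrow> ('a \<Rightarrow> 'a) \<Rightarrow> real \<Rightarrow> real \<Rightarrow> complex set" where
  "exceptional A B \<sigma>\<^sub>1 \<sigma>\<^sub>2 = exceptional1 A B \<sigma>\<^sub>1 \<sigma>\<^sub>2 \<union> exceptional2 A B \<sigma>\<^sub>1 \<sigma>\<^sub>2"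


section \<open>Curves on the closed half-line\<close>

text \<open>Derivatives at the end point \<open>0\<close> are one-sided.\<close>

definition curve_deriv :: "(real \<Rightarrow> complex) \<Rightarrow> real \<Rightarrow> complex" where
  "curve_deriv f t = vector_derivative f (at t within {0..})"

definition C1_curve :: "(real \<Rightarrow> complex) \<Rightarrow> bool" where
  "C1_curve f \<longleftrightarrow> (\<forall>t\<ge>0. f differentiable (at t within {0..})) \<and>
     continuous_on {0..} (curve_deriv f)"

definition real_analytic_curve :: "(real \<Rightarrow> complex) \<Rightarrow> bool" where
  "real_analytic_curve f \<longleftrightarrow> (\<forall>t\<^sub>0\<ge>0. \<exists>r>0. \<exists>a :: nat \<Rightarrow> complex.
     \<forall>t\<ge>0. \<bar>t - t\<^sub>0\<bar> < r \<longrightarrow> (\<lambda>n. a n * complex_of_real (t - t\<^sub>0) ^ n) sums f t)"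

text \<open>The curves are indexed by \<open>r \<in> {0..<N}\<close>.\<close>

definition eigenvalue_curves ::
    "('a::complex_inner_space \<Rightarrow> 'a) \<Rightarrow> ('a \<Rightarrow> 'a) \<Rightarrow> (real \<Rightarrow> complex) \<Rightarrow> nat \<Rightarrow>
     (nat \<Rightarrow> real \<Rightarrow> complex) \<Rightarrow> bool" where
  "eigenvalue_curves A B g N ev \<longleftrightarrow>
     (\<forall>r<N. C1_curve (ev r) \<and> (\<forall>t>0. Im (ev r t) > 0) \<and> (\<forall>t\<ge>0. curve_deriv (ev r) t \<noteq> 0)) \<and>
     (\<forall>t\<ge>0. Spec (perturbed A B (g t)) = {ev r t | r. r < N})"

end

theory Submission
  imports Defs "HOL-Complex_Analysis.Complex_Analysis" "Subresultants.Subresultant_Gcd"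
    "HOL-Computational_Algebra.Field_as_Ring"
begin

text \<open>
  Write \<open>p(\<gamma>, \<lambda>) = det (A + \<gamma> B - \<lambda>)\<close>. Its zeros in \<open>\<lambda>\<close> are the
  eigenvalues of \<open>A + \<gamma> B\<close>, so the theorem is about the zero set of a polynomial in two
  variables, followed along the curve \<open>\<gamma> = g(t)\<close>.

  \<^item> Existence and regularity. Over the set of those \<open>\<gamma>\<close> for which \<open>p(\<gamma>, \<cdot>)\<close> has
  \<open>N\<close> distinct zeros, the implicit function theorem turns the zero set into a covering space with
  \<open>N\<close> sheets (\<open>zero_set_covering_space\<close>). The curve \<open>g\<close> stays in this set: at \<open>t = 0\<close> because the
  eigenvalues of \<open>A\<close> are simple, later because \<open>g\<close> avoids the zeros of the discriminant. Lifting \<open>g\<close>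
  through the covering gives the \<open>N\<close> curves (\<open>continuous_zero_curves\<close>). Locally each of them is
  \<open>\<phi> \<circ> g\<close> with \<open>\<phi>\<close> holomorphic, hence it inherits continuous differentiability or real
  analyticity from \<open>g\<close>, and \<open>\<lambda>\<^sub>r' = - (p\<^sub>\<gamma> / p\<^sub>\<lambda>) g'\<close>.

  \<^item> Non-vanishing of \<open>\<lambda>\<^sub>r'\<close>, that is, of \<open>p\<^sub>\<gamma>\<close>. For \<open>t > 0\<close> the polynomial
  \<open>s \<mapsto> p(s, \<lambda>\<^sub>r(t))\<close> has degree at most \<open>M\<close>, because \<open>B\<close> occupies only \<open>M\<close> rows in a
  suitable basis, and it has \<open>M\<close> distinct roots off the exceptional set; so all its roots are simple.
  At \<open>t = 0\<close> the value of \<open>p\<^sub>\<gamma>\<close> is a non-zero multiple of \<open>\<langle>Be, e\<rangle>\<close> for an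
  eigenvector \<open>e\<close> of \<open>A\<close> (\<open>pencil_fst_partial_nonzero_at_0\<close>).

  \<^item> The role of cyclicity. If \<open>\<langle>Bf, f\<rangle> = 0\<close> then sectoriality forces \<open>Bf = 0\<close> and
  \<open>B\<^sup>* f = 0\<close>. An eigenvector \<open>f\<close> of \<open>A + \<gamma> B\<close> of this kind would be an eigenvector of \<open>A\<close>
  orthogonal to every \<open>A\<^sup>n B v\<close>, hence zero (\<open>eigenvector_form_nonzero\<close>). So
  \<open>\<langle>Bf, f\<rangle> \<noteq> 0\<close> for all eigenvectors; taking imaginary parts in
  \<open>\<lambda> \<langle>f, f\<rangle> = \<langle>Af, f\<rangle> + \<gamma> \<langle>Bf, f\<rangle>\<close> puts the
  spectrum into the upper half-plane.

  \<^item> Asymptotics. Put \<open>\<epsilon> = 1 / \<gamma>\<close>. The function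
  \<open>\<epsilon>\<^sup>N p(1/\<epsilon>, \<mu>/\<epsilon>) = det (B + \<epsilon> A - \<mu>)\<close> has at \<open>\<epsilon> = 0\<close> the
  simple zeros \<open>\<beta>\<^sub>r\<close>. In a basis adapted to the orthogonal sum of the range and the kernel of
  \<open>B\<close>, the function \<open>\<epsilon>\<^sup>M p(1/\<epsilon>, \<lambda>)\<close> is again a polynomial, and at \<open>\<epsilon> = 0\<close>
  it equals a non-zero constant times \<open>det (A\<^sup>\<natural> - \<lambda>)\<close> with the simple zeros
  \<open>\<delta>\<^sub>r\<close>. The implicit function theorem at \<open>\<epsilon> = 0\<close> therefore yields \<open>M\<close> branches of
  eigenvalues that grow like \<open>\<beta>\<^sub>r g\<close> and \<open>N - M\<close> branches that converge to \<open>\<delta>\<^sub>r\<close>. For large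
  \<open>t\<close> these are \<open>N\<close> distinct eigenvalues, that is, all of them, and by connectedness every
  \<open>\<lambda>\<^sub>r\<close> stays on a single branch (\<open>branch_constant_on_connected\<close>). This matching is the
  permutation (\<open>eigenvalue_asymptotics\<close>).
\<close>

section \<open>Functions of two complex variables with continuous partial derivatives\<close>

definition has_partials ::
    "(complex \<Rightarrow> complex \<Rightarrow> complex) \<Rightarrow> (complex \<Rightarrow> complex \<Rightarrow> complex) \<Rightarrow>
     (complex \<Rightarrow> complex \<Rightarrow> complex) \<Rightarrow> bool" where
  "has_partials f f1 f2 \<longleftrightarrow>
     continuous_on UNIV (\<lambda>z. f1 (fst z) (snd z)) \<and>
     continuous_on UNIV (\<lambda>z. f2 (fst z) (snd z)) \<and>
     (\<forall>z. ((\<lambda>z. f (fst z) (snd z)) has_derivative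
            (\<lambda>h. f1 (fst z) (snd z) * fst h + f2 (fst z) (snd z) * snd h)) (at z))"

text \<open>A regularity condition which the closure properties below pass on from the entries of a matrix to
  its determinant, and which is strong enough for the implicit function theorem.\<close>
definition jointly_C1 :: "(complex \<Rightarrow> complex \<Rightarrow> complex) \<Rightarrow> bool" where
  "jointly_C1 f \<longleftrightarrow> (\<exists>f1 f2. has_partials f f1 f2)"

lemma has_partials_continuous:
  assumes "has_partials f f1 f2"
  shows "continuous_on UNIV (\<lambda>z. f (fst z) (snd z))"
proof (rule continuous_at_imp_continuous_on, rule ballI)
  fix z
  show "isCont (\<lambda>z. f (fst z) (snd z)) z"
    using assms unfolding has_partials_def by (meson has_derivative_continuous)
qed

lemma has_partials_snd_deriv:
  assumes "has_partials f f1 f2"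
  shows "((\<lambda>y. f x y) has_field_derivative f2 x y) (at y)"
proof -
  have d: "((\<lambda>z. f (fst z) (snd z)) has_derivative (\<lambda>h. f1 x y * fst h + f2 x y * snd h))
        (at (x, y))"
    using assms[unfolded has_partials_def, THEN conjunct2, THEN conjunct2, rule_format, of "(x, y)"]
    by simp
  have p: "((\<lambda>y. (x, y)) has_derivative (\<lambda>h. (0, h))) (at y)"
    by (rule has_derivative_Pair[OF has_derivative_const has_derivative_ident])
  have "((\<lambda>z. f (fst z) (snd z)) \<circ> (\<lambda>y. (x, y)) has_derivative
      (\<lambda>h. f1 x y * fst h + f2 x y * snd h) \<circ> (\<lambda>h. (0, h))) (at y)"
    by (rule diff_chain_at[OF p d])
  then show ?thesis
    by (simp add: has_field_derivative_def o_def)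
qed

lemma has_partials_fst_deriv:
  assumes "has_partials f f1 f2"
  shows "((\<lambda>x. f x y) has_field_derivative f1 x y) (at x)"
proof -
  have d: "((\<lambda>z. f (fst z) (snd z)) has_derivative (\<lambda>h. f1 x y * fst h + f2 x y * snd h))
        (at (x, y))"
    using assms[unfolded has_partials_def, THEN conjunct2, THEN conjunct2, rule_format, of "(x, y)"]
    by simp
  have p: "((\<lambda>x. (x, y)) has_derivative (\<lambda>h. (h, 0))) (at x)"
    by (rule has_derivative_Pair[OF has_derivative_ident has_derivative_const])
  have "((\<lambda>z. f (fst z) (snd z)) \<circ> (\<lambda>x. (x, y)) has_derivative
      (\<lambda>h. f1 x y * fst h + f2 x y * snd h) \<circ> (\<lambda>h. (h, 0))) (at x)"
    by (rule diff_chain_at[OF p d])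
  then show ?thesis
    by (simp add: has_field_derivative_def o_def)
qed

lemma jointly_C1_const [intro]: "jointly_C1 (\<lambda>x y. c)"
  unfolding jointly_C1_def has_partials_def
  by (rule exI[of _ "\<lambda>_ _. 0"], rule exI[of _ "\<lambda>_ _. 0"]) auto

lemma jointly_C1_fst [intro]: "jointly_C1 (\<lambda>x y. x)"
  unfolding jointly_C1_def has_partials_def
  by (rule exI[of _ "\<lambda>_ _. 1"], rule exI[of _ "\<lambda>_ _. 0"]) (auto intro!: derivative_eq_intros)

lemma jointly_C1_snd [intro]: "jointly_C1 (\<lambda>x y. y)"
  unfolding jointly_C1_def has_partials_def
  by (rule exI[of _ "\<lambda>_ _. 0"], rule exI[of _ "\<lambda>_ _. 1"]) (auto intro!: derivative_eq_intros)

lemma jointly_C1_add [intro]: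
  assumes "jointly_C1 f" "jointly_C1 g"
  shows "jointly_C1 (\<lambda>x y. f x y + g x y)"
proof -
  from assms obtain f1 f2 g1 g2 where "has_partials f f1 f2" "has_partials g g1 g2"
    unfolding jointly_C1_def by blast
  then have "has_partials (\<lambda>x y. f x y + g x y) (\<lambda>x y. f1 x y + g1 x y) (\<lambda>x y. f2 x y + g2 x y)"
    unfolding has_partials_def
    by (auto intro!: continuous_on_add derivative_eq_intros simp: algebra_simps)
  then show ?thesis
    unfolding jointly_C1_def by blast
qed

lemma jointly_C1_mult [intro]:
  assumes "jointly_C1 f" "jointly_C1 g"
  shows "jointly_C1 (\<lambda>x y. f x y * g x y)"
proof -
  from assms obtain f1 f2 g1 g2 where fg: "has_partials f f1 f2" "has_partials g g1 g2"
    unfolding jointly_C1_def by blast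
  have "has_partials (\<lambda>x y. f x y * g x y) (\<lambda>x y. f x y * g1 x y + f1 x y * g x y)
      (\<lambda>x y. f x y * g2 x y + f2 x y * g x y)"
    using fg fg[THEN has_partials_continuous] unfolding has_partials_def
    by (auto intro!: continuous_intros derivative_eq_intros simp: algebra_simps)
  then show ?thesis
    unfolding jointly_C1_def by blast
qed

lemma jointly_C1_sum [intro]:
  assumes "\<And>i. i \<in> I \<Longrightarrow> jointly_C1 (f i)"
  shows "jointly_C1 (\<lambda>x y. \<Sum>i\<in>I. f i x y)"
  using assms by (induction I rule: infinite_finite_induct) auto

lemma jointly_C1_prod [intro]:
  assumes "\<And>i. i \<in> I \<Longrightarrow> jointly_C1 (f i)"
  shows "jointly_C1 (\<lambda>x y. \<Prod>i\<in>I. f i x y)"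
  using assms by (induction I rule: infinite_finite_induct) auto

lemma jointly_C1_diff [intro]:
  assumes "jointly_C1 f" "jointly_C1 g"
  shows "jointly_C1 (\<lambda>x y. f x y - g x y)"
  using jointly_C1_add[OF assms(1) jointly_C1_mult[OF jointly_C1_const[of "-1"] assms(2)]] by simp

lemma jointly_C1_if:
  assumes "jointly_C1 f" "jointly_C1 g"
  shows "jointly_C1 (\<lambda>x y. if P then f x y else g x y)"
  using assms by (cases P) auto

lemmas jointly_C1_intros = jointly_C1_if jointly_C1_diff jointly_C1_add jointly_C1_mult
  jointly_C1_const jointly_C1_fst jointly_C1_snd

lemma jointly_C1_det:
  assumes "\<And>i j. i < n \<Longrightarrow> j < n \<Longrightarrow> jointly_C1 (\<lambda>x y. m x y i j)"
  shows "jointly_C1 (\<lambda>x y. Determinant.det (Matrix.mat n n (\<lambda>(i, j). m x y i j)))"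
proof -
  have "Determinant.det (Matrix.mat n n (\<lambda>(i, j). m x y i j)) =
      (\<Sum>p | p permutes {0..<n}. signof p * (\<Prod>i=0..<n. m x y i (p i)))" for x y
    by (auto simp: det_def'[of _ n] permutes_in_image intro!: sum.cong prod.cong)
  moreover have "jointly_C1 (\<lambda>x y. \<Sum>p | p permutes {0..<n}. signof p * (\<Prod>i=0..<n. m x y i (p i)))"
    by (intro jointly_C1_sum jointly_C1_mult jointly_C1_const jointly_C1_prod assms)
      (auto dest: permutes_in_image)
  ultimately show ?thesis by simp
qed

section \<open>Implicit functions\<close>

text \<open>The inverse function theorem, applied to \<open>(x, y) \<mapsto> (x, f(x, y))\<close>, inverts this map near
  \<open>(a, b)\<close>; the second component of the inverse along \<open>(x, 0)\<close> is \<open>\<phi>\<close>. Its real derivative is the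
  inverse of a complex linear map, so \<open>\<phi>\<close> is complex differentiable. The last conclusion is the
  injectivity of the map on the neighbourhood \<open>W\<close>.\<close>
theorem implicit_function:
  assumes f: "has_partials f f1 f2" and ab: "f a b = 0" "f2 a b \<noteq> 0"
  obtains r \<phi> W where "r > 0" "\<phi> a = b" "open W" "(a, b) \<in> W"
    "\<And>x. x \<in> ball a r \<Longrightarrow> f x (\<phi> x) = 0"
    "\<And>x. x \<in> ball a r \<Longrightarrow> (\<phi> has_field_derivative - (f1 x (\<phi> x) / f2 x (\<phi> x))) (at x)"
    "\<And>x y. (x, y) \<in> W \<Longrightarrow> x \<in> ball a r \<Longrightarrow> f x y = 0 \<Longrightarrow> y = \<phi> x"
proof -
  define F where "F = (\<lambda>z. (fst z, f (fst z) (snd z)))"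
  define L where "L = (\<lambda>z (h::complex \<times> complex).
    (fst h, f1 (fst z) (snd z) * fst h + f2 (fst z) (snd z) * snd h))"
  have dF: "(F has_derivative L z) (at z)" for z
    using f unfolding has_partials_def F_def L_def
    by (cases z) (auto intro!: has_derivative_Pair derivative_intros simp: split_paired_all)
  then have bl: "bounded_linear (L z)" for z
    using has_derivative_bounded_linear by blast
  have bl_app: "blinfun_apply (Blinfun (L z)) = L z" for z
    by (rule bounded_linear_Blinfun_apply[OF bl])
  have contL: "continuous_on UNIV (\<lambda>z. Blinfun (L z))"
  proof (rule continuous_on_blinfun_componentwise)
    fix i :: "complex \<times> complex"
    show "continuous_on UNIV (\<lambda>z. blinfun_apply (Blinfun (L z)) i)"
      unfolding bl_app using f unfolding has_partials_def L_def
      by (auto intro!: continuous_intros)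
  qed
  define K where "K = (\<lambda>h::complex \<times> complex. (fst h, (snd h - f1 a b * fst h) / f2 a b))"
  have blK: "bounded_linear K"
    unfolding K_def linear_conv_bounded_linear[symmetric]
    by (rule linearI) (simp_all add: algebra_simps add_divide_distrib diff_divide_distrib scaleR_conv_of_real)
  have inv: "Blinfun K o\<^sub>L Blinfun (L (a, b)) = id_blinfun"
  proof (rule blinfun_eqI)
    fix i
    show "blinfun_apply (Blinfun K o\<^sub>L Blinfun (L (a, b))) i = blinfun_apply id_blinfun i"
      using ab(2) by (simp add: bl_app bounded_linear_Blinfun_apply[OF blK]) (simp add: K_def L_def)
  qed
  have "\<And>z. z \<in> UNIV \<Longrightarrow> (F has_derivative blinfun_apply (Blinfun (L z))) (at z)"
    unfolding bl_app by (rule dF)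
  note ift = inverse_function_theorem[OF open_UNIV this contL UNIV_I inv, unfolded bl_app]
  obtain U V g g' where U: "open U" "U \<subseteq> UNIV" "(a, b) \<in> U" "open V" "F (a, b) \<in> V"
      "homeomorphism U V F g"
    and g: "\<And>y. y \<in> V \<Longrightarrow> (g has_derivative (g' y)) (at y)"
      "\<And>y. y \<in> V \<Longrightarrow> g' y = inv_into UNIV (L (g y))" "\<And>y. y \<in> V \<Longrightarrow> bij (L (g y))"
    by (rule ift, blast, rule that)
  have Fab: "F (a, b) = (a, 0)"
    using ab by (simp add: F_def)
  then obtain r where r: "r > 0" "ball (a, 0) r \<subseteq> V"
    using U(4,5) open_contains_ball by metis
  have inV: "(x, 0) \<in> V" if "x \<in> ball a r" for x
    using that r(2) by (auto simp: dist_Pair_Pair subset_iff)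
  define \<phi> where "\<phi> = (\<lambda>x. snd (g (x, 0)))"
  have gU: "g y \<in> U" "F (g y) = y" if "y \<in> V" for y
    using U(6) that unfolding homeomorphism_def by auto
  have gF: "g (F z) = z" if "z \<in> U" for z
    using U(6) that unfolding homeomorphism_def by auto
  have gx: "g (x, 0) = (x, \<phi> x)" "f x (\<phi> x) = 0" if "x \<in> ball a r" for x
    using gU(2)[OF inV[OF that]] unfolding F_def \<phi>_def by (auto simp: prod_eq_iff)
  show ?thesis
  proof (rule that[of r \<phi> U])
    show "\<phi> a = b"
      using gF[OF U(3)] Fab by (simp add: \<phi>_def)
    show "y = \<phi> x" if "(x, y) \<in> U" "x \<in> ball a r" "f x y = 0" for x y
      using gF[OF that(1)] that(3) by (simp add: F_def \<phi>_def)
    fix x assume x: "x \<in> ball a r"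
    have "((\<lambda>x. (x, 0)) has_derivative (\<lambda>h. (h, 0))) (at x)"
      by (rule has_derivative_Pair[OF has_derivative_ident has_derivative_const])
    from diff_chain_at[OF this g(1)[OF inV[OF x]]]
    have "(g \<circ> (\<lambda>x. (x, 0)) has_derivative g' (x, 0) \<circ> (\<lambda>h. (h, 0))) (at x)" .
    from has_derivative_snd[OF this]
    have d\<phi>: "(\<phi> has_derivative (\<lambda>h. snd (g' (x, 0) (h, 0)))) (at x)"
      by (simp add: \<phi>_def o_def)
    have bij: "bij (L (x, \<phi> x))"
      using g(3)[OF inV[OF x]] gx(1)[OF x] by simp
    have f2: "f2 x (\<phi> x) \<noteq> 0"
    proof
      assume "f2 x (\<phi> x) = 0"
      then have "L (x, \<phi> x) (0, 1) = L (x, \<phi> x) (0, 0)"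
        by (simp add: L_def)
      then show False
        using injD[OF bij_is_inj[OF bij]] by fastforce
    qed
    have "snd (g' (x, 0) (h, 0)) = - (f1 x (\<phi> x) / f2 x (\<phi> x)) * h" for h
    proof -
      have "L (x, \<phi> x) (h, - (f1 x (\<phi> x) / f2 x (\<phi> x)) * h) = (h, 0)"
        using f2 by (simp add: L_def)
      then have "inv_into UNIV (L (x, \<phi> x)) (h, 0) = (h, - (f1 x (\<phi> x) / f2 x (\<phi> x)) * h)"
        using inv_f_eq[OF bij_is_inj[OF bij]] by blast
      then show ?thesis
        using g(2)[OF inV[OF x]] gx(1)[OF x] by simp
    qed
    then have "(\<lambda>h. snd (g' (x, 0) (h, 0))) = (*) (- (f1 x (\<phi> x) / f2 x (\<phi> x)))"
      by auto
    then show "(\<phi> has_field_derivative - (f1 x (\<phi> x) / f2 x (\<phi> x))) (at x)"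
      using d\<phi> unfolding has_field_derivative_def by simp
  qed (use r U gx in auto)
qed

section \<open>Regularity of curves of zeros\<close>

text \<open>By local uniqueness in the implicit function theorem, a continuous curve of zeros cannot
  leave the graph of the implicit function near \<open>t\<^sub>0\<close>.\<close>
lemma root_curve_local_branch:
  assumes f: "has_partials f f1 f2" and "f2 (g t\<^sub>0) (ev t\<^sub>0) \<noteq> 0"
    and g: "continuous_on {0..} g" and ev: "continuous_on {0..} ev"
    and zero: "\<And>t. t \<ge> 0 \<Longrightarrow> f (g t) (ev t) = 0" and "t\<^sub>0 \<ge> (0::real)"
  obtains r \<phi> d where "r > 0" "d > 0" "\<phi> (g t\<^sub>0) = ev t\<^sub>0"
    "\<And>x. x \<in> ball (g t\<^sub>0) r \<Longrightarrow>
       (\<phi> has_field_derivative - (f1 x (\<phi> x) / f2 x (\<phi> x))) (at x)"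
    "\<And>t. t \<ge> 0 \<Longrightarrow> dist t t\<^sub>0 < d \<Longrightarrow> g t \<in> ball (g t\<^sub>0) r \<and> ev t = \<phi> (g t)"
proof -
  obtain r \<phi> W where r: "r > 0" "\<phi> (g t\<^sub>0) = ev t\<^sub>0" "open W" "(g t\<^sub>0, ev t\<^sub>0) \<in> W"
    and d\<phi>: "\<And>x. x \<in> ball (g t\<^sub>0) r \<Longrightarrow>
       (\<phi> has_field_derivative - (f1 x (\<phi> x) / f2 x (\<phi> x))) (at x)"
    and uniq: "\<And>x y. (x, y) \<in> W \<Longrightarrow> x \<in> ball (g t\<^sub>0) r \<Longrightarrow> f x y = 0 \<Longrightarrow> y = \<phi> x"
    using implicit_function[OF f, of "g t\<^sub>0" "ev t\<^sub>0"] assms(2) zero[OF \<open>t\<^sub>0 \<ge> 0\<close>] by metis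
  define S where "S = W \<inter> (ball (g t\<^sub>0) r \<times> UNIV)"
  have S: "open S" "(g t\<^sub>0, ev t\<^sub>0) \<in> S"
    using r unfolding S_def by (auto intro!: open_Int open_Times)
  have "continuous_on {0..} (\<lambda>t. (g t, ev t))"
    using g ev by (intro continuous_intros)
  then have "((\<lambda>t. (g t, ev t)) \<longlongrightarrow> (g t\<^sub>0, ev t\<^sub>0)) (at t\<^sub>0 within {0..})"
    using \<open>t\<^sub>0 \<ge> 0\<close> unfolding continuous_on_def by auto
  then have "eventually (\<lambda>t. (g t, ev t) \<in> S) (at t\<^sub>0 within {0..})"
    using S by (rule topological_tendstoD)
  then obtain d where d: "d > 0" "\<And>t. t \<ge> 0 \<Longrightarrow> t \<noteq> t\<^sub>0 \<Longrightarrow> dist t t\<^sub>0 < d \<Longrightarrow> (g t, ev t) \<in> S"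
    unfolding eventually_at by auto
  show ?thesis
  proof (rule that[OF r(1) d(1) r(2) d\<phi>])
    fix t :: real assume t: "t \<ge> 0" "dist t t\<^sub>0 < d"
    have "(g t, ev t) \<in> S"
      using d(2) t S(2) by (cases "t = t\<^sub>0") auto
    then show "g t \<in> ball (g t\<^sub>0) r \<and> ev t = \<phi> (g t)"
      using uniq zero[OF t(1)] unfolding S_def by auto
  qed auto
qed

lemma root_curve_derivative:
  assumes f: "has_partials f f1 f2" and "f2 (g t\<^sub>0) (ev t\<^sub>0) \<noteq> 0"
    and g: "continuous_on {0..} g" and ev: "continuous_on {0..} ev"
    and zero: "\<And>t. t \<ge> 0 \<Longrightarrow> f (g t) (ev t) = 0" and t0: "t\<^sub>0 \<ge> (0::real)"
    and g': "(g has_vector_derivative g') (at t\<^sub>0 within {0..})"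
  shows "(ev has_vector_derivative - (f1 (g t\<^sub>0) (ev t\<^sub>0) / f2 (g t\<^sub>0) (ev t\<^sub>0)) * g')
     (at t\<^sub>0 within {0..})"
proof -
  obtain r \<phi> d where *: "r > 0" "d > 0" "\<phi> (g t\<^sub>0) = ev t\<^sub>0"
    "\<And>x. x \<in> ball (g t\<^sub>0) r \<Longrightarrow>
       (\<phi> has_field_derivative - (f1 x (\<phi> x) / f2 x (\<phi> x))) (at x)"
    "\<And>t. t \<ge> 0 \<Longrightarrow> dist t t\<^sub>0 < d \<Longrightarrow> g t \<in> ball (g t\<^sub>0) r \<and> ev t = \<phi> (g t)"
    using root_curve_local_branch[of f f1 f2 g t\<^sub>0 ev] assms(1-6) by metis
  have "(\<phi> has_field_derivative - (f1 (g t\<^sub>0) (ev t\<^sub>0) / f2 (g t\<^sub>0) (ev t\<^sub>0)))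
      (at (g t\<^sub>0) within g ` {0..})"
    using *(4)[of "g t\<^sub>0"] *(1,3) has_field_derivative_at_within by fastforce
  from field_vector_diff_chain_within[OF g' this]
  have "(\<phi> \<circ> g has_vector_derivative g' * - (f1 (g t\<^sub>0) (ev t\<^sub>0) / f2 (g t\<^sub>0) (ev t\<^sub>0)))
     (at t\<^sub>0 within {0..})" .
  then have "(ev has_vector_derivative g' * - (f1 (g t\<^sub>0) (ev t\<^sub>0) / f2 (g t\<^sub>0) (ev t\<^sub>0)))
     (at t\<^sub>0 within {0..})"
    by (rule has_vector_derivative_transform_within[OF _ *(2)]) (use t0 *(5) in auto)
  then show ?thesis
    by (simp add: mult.commute)
qed

lemma at_within_nonneg_nontrivial: "t \<ge> 0 \<Longrightarrow> at t within {0..} \<noteq> (bot :: real filter)"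
proof -
  assume "t \<ge> 0"
  then have "at_right t \<le> at t within {0..}"
    by (intro at_le) auto
  then show ?thesis
    by (metis bot.extremum_uniqueI trivial_limit_at_right_real)
qed

lemma curve_deriv_eq:
  assumes "t \<ge> 0" "(f has_vector_derivative f') (at t within {0..})"
  shows "curve_deriv f t = f'"
  unfolding curve_deriv_def
  using vector_derivative_within[OF at_within_nonneg_nontrivial[OF assms(1)] assms(2)] .

lemma C1_curve_has_deriv:
  assumes "C1_curve f" "t \<ge> 0"
  shows "(f has_vector_derivative curve_deriv f t) (at t within {0..})"
  using assms unfolding C1_curve_def curve_deriv_def by (simp add: vector_derivative_works)

lemma C1_curve_continuous:
  assumes "C1_curve f"
  shows "continuous_on {0..} f"
  using assms unfolding C1_curve_def
  by (meson atLeast_iff continuous_on_eq_continuous_within differentiable_imp_continuous_within)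

lemma root_curve_C1:
  assumes f: "has_partials f f1 f2" and f2: "\<And>t. t \<ge> 0 \<Longrightarrow> f2 (g t) (ev t) \<noteq> 0"
    and g: "C1_curve g" and ev: "continuous_on {0..} ev"
    and zero: "\<And>t. t \<ge> 0 \<Longrightarrow> f (g t) (ev t) = 0"
  shows "C1_curve ev"
    and "t \<ge> 0 \<Longrightarrow> curve_deriv ev t = - (f1 (g t) (ev t) / f2 (g t) (ev t)) * curve_deriv g t"
proof -
  note gc = C1_curve_continuous[OF g]
  have d: "(ev has_vector_derivative - (f1 (g t) (ev t) / f2 (g t) (ev t)) * curve_deriv g t)
      (at t within {0..})" if "t \<ge> 0" for t
    by (rule root_curve_derivative[OF f f2 gc ev zero])
      (use that C1_curve_has_deriv[OF g] in auto)
  show e: "curve_deriv ev t = - (f1 (g t) (ev t) / f2 (g t) (ev t)) * curve_deriv g t"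
    if "t \<ge> 0" for t
    using curve_deriv_eq[OF that d[OF that]] .
  have pair: "continuous_on {0..} (\<lambda>t. (g t, ev t))"
    using gc ev by (intro continuous_intros)
  have c1: "continuous_on {0..} (\<lambda>t. f1 (g t) (ev t))"
    using continuous_on_compose2[OF _ pair, of UNIV "\<lambda>z. f1 (fst z) (snd z)"] f
    unfolding has_partials_def by auto
  have c2: "continuous_on {0..} (\<lambda>t. f2 (g t) (ev t))"
    using continuous_on_compose2[OF _ pair, of UNIV "\<lambda>z. f2 (fst z) (snd z)"] f
    unfolding has_partials_def by auto
  have "continuous_on {0..} (\<lambda>t. - (f1 (g t) (ev t) / f2 (g t) (ev t)) * curve_deriv g t)"
    using c1 c2 f2 g unfolding C1_curve_def by (auto intro!: continuous_intros)
  then have "continuous_on {0..} (curve_deriv ev)"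
    by (rule continuous_on_eq) (use e in auto)
  then show "C1_curve ev"
    using d unfolding C1_curve_def by (meson differentiableI_vector)
qed

text \<open>A convergent power series of \<open>g\<close> around \<open>t\<^sub>0\<close> extends \<open>g\<close> to a holomorphic function \<open>G\<close> on a
  complex disc. Since \<open>ev = \<phi> \<circ> g\<close> locally, the Taylor series of the holomorphic function
  \<open>\<phi> \<circ> G\<close> represents \<open>ev\<close>.\<close>
lemma root_curve_real_analytic:
  assumes f: "has_partials f f1 f2" and f2: "\<And>t. t \<ge> 0 \<Longrightarrow> f2 (g t) (ev t) \<noteq> 0"
    and g: "continuous_on {0..} g" and ev: "continuous_on {0..} ev"
    and zero: "\<And>t. t \<ge> 0 \<Longrightarrow> f (g t) (ev t) = 0"
    and ana: "real_analytic_curve g"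
  shows "real_analytic_curve ev"
  unfolding real_analytic_curve_def
proof (intro allI impI)
  fix t\<^sub>0 :: real assume t0: "t\<^sub>0 \<ge> 0"
  obtain r \<phi> d where *: "r > 0" "d > 0"
    and d\<phi>: "\<And>x. x \<in> ball (g t\<^sub>0) r \<Longrightarrow>
       (\<phi> has_field_derivative - (f1 x (\<phi> x) / f2 x (\<phi> x))) (at x)"
    and ev\<phi>: "\<And>t. t \<ge> 0 \<Longrightarrow> dist t t\<^sub>0 < d \<Longrightarrow> g t \<in> ball (g t\<^sub>0) r \<and> ev t = \<phi> (g t)"
    using root_curve_local_branch[OF f f2[OF t0] g ev zero t0] by metis
  have hol\<phi>: "\<phi> holomorphic_on ball (g t\<^sub>0) r"
    using d\<phi> by (meson holomorphic_on_open open_ball)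
  obtain s a where s: "s > 0"
    and a: "\<And>t. t \<ge> 0 \<Longrightarrow> \<bar>t - t\<^sub>0\<bar> < s \<Longrightarrow> (\<lambda>n. a n * complex_of_real (t - t\<^sub>0) ^ n) sums g t"
    using ana t0 unfolding real_analytic_curve_def by metis
  define G where "G = (\<lambda>z. \<Sum>n. a n * (z - complex_of_real t\<^sub>0) ^ n)"
  have Gsums: "(\<lambda>n. a n * (z - complex_of_real t\<^sub>0) ^ n) sums G z"
    if z: "z \<in> ball (complex_of_real t\<^sub>0) s" for z
  proof -
    obtain u where u: "norm (z - complex_of_real t\<^sub>0) < u" "u < s"
      using z dense[of "norm (z - complex_of_real t\<^sub>0)" s]
      by (auto simp: dist_norm norm_minus_commute)
    have "u \<ge> 0" using u(1) norm_ge_zero[of "z - complex_of_real t\<^sub>0"] by linarith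
    then have "summable (\<lambda>n. a n * complex_of_real u ^ n)"
      using a[of "t\<^sub>0 + u"] t0 u(2) by (auto simp: sums_iff)
    then have "summable (\<lambda>n. a n * (z - complex_of_real t\<^sub>0) ^ n)"
      by (rule powser_inside) (use u(1) \<open>u \<ge> 0\<close> in auto)
    then show ?thesis unfolding G_def by (rule summable_sums)
  qed
  then have holG: "G holomorphic_on ball (complex_of_real t\<^sub>0) s"
    by (rule power_series_holomorphic)
  have Gg: "G (complex_of_real t) = g t" if "t \<ge> 0" "\<bar>t - t\<^sub>0\<bar> < s" for t
    using sums_unique2[OF Gsums[of "complex_of_real t"] , of "g t"] a[OF that] that
    by (simp add: dist_of_real dist_real_def abs_minus_commute)
  have "continuous_on (ball (complex_of_real t\<^sub>0) s) G"
    using holG holomorphic_on_imp_continuous_on by blast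
  then have "isCont G (complex_of_real t\<^sub>0)"
    using s by (simp add: continuous_on_eq_continuous_at)
  then obtain s' where s': "s' > 0"
    "\<And>z. dist z (complex_of_real t\<^sub>0) < s' \<Longrightarrow> dist (G z) (G (complex_of_real t\<^sub>0)) < r"
    unfolding continuous_at_eps_delta using * by metis
  define q where "q = min d (min s s')"
  have q: "q > 0" using * s s' by (simp add: q_def)
  have "\<phi> \<circ> G holomorphic_on ball (complex_of_real t\<^sub>0) q"
  proof (rule holomorphic_on_compose_gen[OF _ hol\<phi>])
    show "G holomorphic_on ball (complex_of_real t\<^sub>0) q"
      using holG by (rule holomorphic_on_subset) (auto simp: q_def)
    show "G ` ball (complex_of_real t\<^sub>0) q \<subseteq> ball (g t\<^sub>0) r"
      using s'(2) Gg[OF t0] s by (auto simp: q_def dist_commute)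
  qed
  note ps = holomorphic_power_series[OF this]
  show "\<exists>r>0. \<exists>a. \<forall>t\<ge>0. \<bar>t - t\<^sub>0\<bar> < r \<longrightarrow> (\<lambda>n. a n * complex_of_real (t - t\<^sub>0) ^ n) sums ev t"
  proof (intro exI[of _ q] conjI q exI allI impI)
    fix t :: real assume t: "t \<ge> 0" "\<bar>t - t\<^sub>0\<bar> < q"
    have "complex_of_real t \<in> ball (complex_of_real t\<^sub>0) q"
      using t by (simp add: dist_of_real dist_real_def abs_minus_commute)
    from ps[OF this]
    show "(\<lambda>n. ((deriv ^^ n) (\<phi> \<circ> G) (complex_of_real t\<^sub>0) / fact n) * complex_of_real (t - t\<^sub>0) ^ n)
        sums ev t"
      using Gg[OF t(1)] ev\<phi>[OF t(1)] t by (simp add: q_def dist_real_def)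
  qed
qed

section \<open>Zero sets as covering spaces\<close>

text \<open>The set on which \<open>f\<close> agrees with one branch is closed, and its complement is the finite
  union of the corresponding closed sets of the other branches.\<close>
lemma branch_constant_on_connected:
  fixes f :: "'a::topological_space \<Rightarrow> 'b::real_normed_vector"
  assumes "connected S" "finite K" "continuous_on S f" "\<And>k. k \<in> K \<Longrightarrow> continuous_on S (h k)"
    and cover: "\<And>t. t \<in> S \<Longrightarrow> \<exists>k\<in>K. f t = h k t"
    and dist: "\<And>t k l. t \<in> S \<Longrightarrow> k \<in> K \<Longrightarrow> l \<in> K \<Longrightarrow> h k t = h l t \<Longrightarrow> k = l"
    and "S \<noteq> {}"
  obtains k where "k \<in> K" "\<And>t. t \<in> S \<Longrightarrow> f t = h k t"
proof -
  define E where "E = (\<lambda>k. {t \<in> S. f t - h k t = 0})"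
  have cl: "closedin (top_of_set S) (E k)" if "k \<in> K" for k
    unfolding E_def
    by (rule continuous_closedin_preimage_constant) (use assms that in \<open>auto intro!: continuous_intros\<close>)
  obtain t\<^sub>0 where t0: "t\<^sub>0 \<in> S" using \<open>S \<noteq> {}\<close> by auto
  obtain k where k: "k \<in> K" "f t\<^sub>0 = h k t\<^sub>0" using cover[OF t0] by auto
  have "S - E k = (\<Union>l\<in>K - {k}. E l)"
    using cover dist k(1) unfolding E_def by fastforce
  moreover have "closedin (top_of_set S) (\<Union>l\<in>K - {k}. E l)"
    using cl \<open>finite K\<close> by (intro closedin_Union) auto
  ultimately have "openin (top_of_set S) (E k)"
    by (metis (no_types, lifting) E_def mem_Collect_eq openin_closedin_eq subsetI topspace_euclidean_subtopology)
  then have "E k = S"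
    using cl[OF k(1)] \<open>connected S\<close> t0 k(2) unfolding connected_clopen E_def by auto
  then show ?thesis
    by (intro that[OF k(1)]) (auto simp: E_def)
qed

text \<open>Simultaneous implicit functions through finitely many simple zeros over \<open>a\<close>, with values so
  close to these zeros that the graphs are disjoint once \<open>e\<close> is half of their separation.\<close>
lemma zero_sheets:
  assumes f: "has_partials f f1 f2" and "finite R"
    and R: "\<And>b. b \<in> R \<Longrightarrow> f a b = 0" "\<And>b. b \<in> R \<Longrightarrow> f2 a b \<noteq> 0" and "e > 0"
  obtains r \<Phi> where "r > 0" "\<And>b. b \<in> R \<Longrightarrow> \<Phi> b a = b"
    "\<And>b. b \<in> R \<Longrightarrow> continuous_on (ball a r) (\<Phi> b)"
    "\<And>b x. b \<in> R \<Longrightarrow> x \<in> ball a r \<Longrightarrow> f x (\<Phi> b x) = 0"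
    "\<And>b x. b \<in> R \<Longrightarrow> x \<in> ball a r \<Longrightarrow> dist (\<Phi> b x) b < e"
proof -
  have "\<forall>b\<in>R. \<exists>\<phi> r. r > 0 \<and> \<phi> a = b \<and> continuous_on (ball a r) \<phi> \<and>
      (\<forall>x\<in>ball a r. f x (\<phi> x) = 0 \<and> dist (\<phi> x) b < e)"
  proof
    fix b assume "b \<in> R"
    obtain r \<phi> W where r: "r > 0" "\<phi> a = b" "\<And>x. x \<in> ball a r \<Longrightarrow> f x (\<phi> x) = 0"
      "\<And>x. x \<in> ball a r \<Longrightarrow> (\<phi> has_field_derivative - (f1 x (\<phi> x) / f2 x (\<phi> x))) (at x)"
      using implicit_function[OF f R[OF \<open>b \<in> R\<close>]] by metis
    have c: "isCont \<phi> x" if "x \<in> ball a r" for x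
      using r(4)[OF that] DERIV_isCont by blast
    obtain d where d: "d > 0" "\<And>x. dist x a < d \<Longrightarrow> dist (\<phi> x) (\<phi> a) < e"
      using c[of a] r(1) \<open>e > 0\<close> unfolding continuous_at_eps_delta by auto
    show "\<exists>\<phi> r. r > 0 \<and> \<phi> a = b \<and> continuous_on (ball a r) \<phi> \<and>
      (\<forall>x\<in>ball a r. f x (\<phi> x) = 0 \<and> dist (\<phi> x) b < e)"
      using r(1-3) d c
      by (intro exI[of _ \<phi>] exI[of _ "min d r"] conjI ballI continuous_at_imp_continuous_on)
        (auto simp: dist_commute)
  qed
  then obtain \<Phi> \<rho> where \<Phi>: "\<And>b. b \<in> R \<Longrightarrow> \<rho> b > 0 \<and> \<Phi> b a = b \<and> continuous_on (ball a (\<rho> b)) (\<Phi> b) \<and>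
      (\<forall>x\<in>ball a (\<rho> b). f x (\<Phi> b x) = 0 \<and> dist (\<Phi> b x) b < e)"
    by metis
  define r where "r = Min (insert 1 (\<rho> ` R))"
  have r: "r > 0"
    using \<Phi> \<open>finite R\<close> by (auto simp: r_def)
  have sub: "ball a r \<subseteq> ball a (\<rho> b)" if "b \<in> R" for b
    using that \<open>finite R\<close> by (intro subset_ball) (auto simp: r_def)
  show ?thesis
  proof (rule that[of r \<Phi>])
    fix b assume "b \<in> R"
    note b = \<Phi>[OF this] sub[OF this]
    show "\<Phi> b a = b" "continuous_on (ball a r) (\<Phi> b)"
      using b by (auto intro: continuous_on_subset)
    show "f x (\<Phi> b x) = 0" "dist (\<Phi> b x) b < e" if "x \<in> ball a r" for x
      using b that by blast+
  qed (rule r)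
qed

lemma finite_separation:
  fixes R :: "'a::metric_space set"
  assumes "finite R"
  obtains e where "e > 0" "\<And>b c. b \<in> R \<Longrightarrow> c \<in> R \<Longrightarrow> b \<noteq> c \<Longrightarrow> 2 * e \<le> dist b c"
proof -
  define D where "D = insert 1 ((\<lambda>(b, c). dist b c) ` {(b, c) \<in> R \<times> R. b \<noteq> c})"
  have "finite {(b, c) \<in> R \<times> R. b \<noteq> c}"
    using assms by (auto intro: finite_subset[of _ "R \<times> R"])
  then have fin: "finite D" by (simp add: D_def)
  have "Min D > 0"
    using fin unfolding D_def by (subst Min_gr_iff) auto
  moreover have "Min D \<le> dist b c" if "b \<in> R" "c \<in> R" "b \<noteq> c" for b c
    using that by (intro Min_le[OF fin]) (auto simp: D_def image_iff)
  ultimately show ?thesis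
    by (intro that[of "Min D / 2"]) auto
qed

text \<open>Over a small ball around a point with \<open>N\<close> simple zeros, the \<open>N\<close> implicit functions have
  distinct values. As there are never more than \<open>N\<close> zeros, they exhaust the zero set over the ball;
  so their graphs are the sheets.\<close>
lemma zero_set_covering_space:
  assumes f: "has_partials f f1 f2"
    and fin: "\<And>x. finite {y. f x y = 0}" and card: "\<And>x. card {y. f x y = 0} \<le> N" and "N > 0"
    and simple: "\<And>x y. card {y. f x y = 0} = N \<Longrightarrow> f x y = 0 \<Longrightarrow> f2 x y \<noteq> 0"
  defines "D \<equiv> {x. card {y. f x y = 0} = N}"
  shows "covering_space {z. fst z \<in> D \<and> f (fst z) (snd z) = 0} fst D"
    (is "covering_space ?C fst D")
  unfolding covering_space_def
proof (intro conjI ballI)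
  show "continuous_on ?C fst" by (intro continuous_intros)
  show "fst ` ?C = D"
  proof (intro equalityI subsetI)
    fix x assume x: "x \<in> D"
    then have "{y. f x y = 0} \<noteq> {}"
      using \<open>N > 0\<close> unfolding D_def by fastforce
    then obtain y where "f x y = 0" by auto
    then show "x \<in> fst ` ?C"
      using x by (intro image_eqI[of _ _ "(x, y)"]) auto
  qed auto
  fix a assume a: "a \<in> D"
  define R where "R = {y. f a y = 0}"
  have R: "finite R" "card R = N" using fin a by (auto simp: R_def D_def)
  obtain e where e: "e > 0" "\<And>b c. b \<in> R \<Longrightarrow> c \<in> R \<Longrightarrow> b \<noteq> c \<Longrightarrow> 2 * e \<le> dist b c"
    using finite_separation[OF R(1)] by metis
  obtain r \<Phi> where r: "r > 0" and \<Phi>: "\<And>b. b \<in> R \<Longrightarrow> \<Phi> b a = b"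
    "\<And>b. b \<in> R \<Longrightarrow> continuous_on (ball a r) (\<Phi> b)"
    "\<And>b x. b \<in> R \<Longrightarrow> x \<in> ball a r \<Longrightarrow> f x (\<Phi> b x) = 0"
    "\<And>b x. b \<in> R \<Longrightarrow> x \<in> ball a r \<Longrightarrow> dist (\<Phi> b x) b < e"
    by (rule zero_sheets[OF f R(1), of a e]) (use a e simple in \<open>auto simp: R_def D_def\<close>)
  have sep: "b = c" if "b \<in> R" "c \<in> R" "dist y b < e" "dist y c < e" for b c y
    using e(2)[OF that(1,2)] that(3,4) dist_triangle3[of b c y] by fastforce
  have zeros: "(\<lambda>b. \<Phi> b x) ` R = {y. f x y = 0}" "x \<in> D" if x: "x \<in> ball a r" for x
  proof -
    have inj: "inj_on (\<lambda>b. \<Phi> b x) R"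
      using \<Phi>(4)[OF _ x] sep by (intro inj_onI) metis
    show eq: "(\<lambda>b. \<Phi> b x) ` R = {y. f x y = 0}"
    proof (rule card_seteq[OF fin])
      show "(\<lambda>b. \<Phi> b x) ` R \<subseteq> {y. f x y = 0}" using \<Phi>(3)[OF _ x] by auto
      show "card {y. f x y = 0} \<le> card ((\<lambda>b. \<Phi> b x) ` R)"
        using card card_image[OF inj] R by simp
    qed
    show "x \<in> D"
      using card_image[OF inj] R(2) unfolding eq by (simp add: D_def)
  qed
  \<comment> \<open>A zero over the ball is within \<open>e\<close> of exactly one zero over \<open>a\<close>, so these relatively open sets
  separate the graphs.\<close>
  define u where "u = (\<lambda>b. ?C \<inter> (ball a r \<times> ball b e))"
  have u: "u b = (\<lambda>x. (x, \<Phi> b x)) ` ball a r" if b: "b \<in> R" for b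
  proof (intro equalityI subsetI)
    fix z assume z: "z \<in> u b"
    then have x: "fst z \<in> ball a r" "f (fst z) (snd z) = 0"
      unfolding u_def by auto
    then have "snd z \<in> (\<lambda>b. \<Phi> b (fst z)) ` R"
      unfolding zeros(1)[OF x(1)] by simp
    then obtain c where c: "c \<in> R" "snd z = \<Phi> c (fst z)" by blast
    moreover have "c = b"
      using z c \<Phi>(4)[OF c(1), of "fst z"] b unfolding u_def
      by (intro sep[of c b "snd z"]) (auto simp: dist_commute)
    ultimately show "z \<in> (\<lambda>x. (x, \<Phi> b x)) ` ball a r"
      using z unfolding u_def by (intro image_eqI[of _ _ "fst z"]) (auto simp: prod_eq_iff)
  next
    fix z assume "z \<in> (\<lambda>x. (x, \<Phi> b x)) ` ball a r"
    then show "z \<in> u b"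
      using \<Phi>(3,4)[OF b] zeros(2) unfolding u_def by (auto simp: dist_commute)
  qed
  show "\<exists>T. a \<in> T \<and> openin (top_of_set D) T \<and>
           (\<exists>v. \<Union>v = ?C \<inter> fst -` T \<and> (\<forall>u\<in>v. openin (top_of_set ?C) u) \<and>
               pairwise disjnt v \<and> (\<forall>u\<in>v. \<exists>q. homeomorphism u T fst q))"
  proof (intro exI[of _ "ball a r"] conjI exI[of _ "u ` R"])
    show "a \<in> ball a r" using r by simp
    have "ball a r \<subseteq> D" using zeros(2) by auto
    then show "openin (top_of_set D) (ball a r)"
      by (simp add: open_subset)
    show "\<Union>(u ` R) = ?C \<inter> fst -` ball a r"
    proof (intro equalityI subsetI)
      fix z assume z: "z \<in> ?C \<inter> fst -` ball a r"
      then have x: "fst z \<in> ball a r" "f (fst z) (snd z) = 0" by auto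
      then have "snd z \<in> (\<lambda>b. \<Phi> b (fst z)) ` R"
        unfolding zeros(1)[OF x(1)] by simp
      then obtain c where c: "c \<in> R" "snd z = \<Phi> c (fst z)" by blast
      then have "z \<in> u c"
        using z unfolding u[OF c(1)] by (intro image_eqI[of _ _ "fst z"]) (auto simp: prod_eq_iff)
      then show "z \<in> \<Union>(u ` R)" using c by auto
    qed (auto simp: u_def)
    show "\<forall>v\<in>u ` R. openin (top_of_set ?C) v"
      unfolding u_def by (auto intro!: openin_open_Int open_Times)
    show "pairwise disjnt (u ` R)"
    proof (rule pairwiseI)
      fix p q assume "p \<in> u ` R" "q \<in> u ` R" "p \<noteq> q"
      then obtain b c where bc: "b \<in> R" "c \<in> R" "b \<noteq> c" "p = u b" "q = u c" by auto
      show "disjnt p q"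
        using sep[OF bc(1,2)] bc(3) unfolding disjnt_def bc(4,5) u_def by (auto simp: dist_commute)
    qed
    show "\<forall>v\<in>u ` R. \<exists>q. homeomorphism v (ball a r) fst q"
    proof
      fix v assume "v \<in> u ` R"
      then obtain b where b: "b \<in> R" "v = u b" by auto
      have "homeomorphism v (ball a r) fst (\<lambda>x. (x, \<Phi> b x))"
        unfolding b(2) u[OF b(1)] using \<Phi>(2)[OF b(1)]
        by (intro homeomorphismI) (auto intro!: continuous_intros)
      then show "\<exists>q. homeomorphism v (ball a r) fst q" by blast
    qed
  qed
qed

text \<open>The half-line is simply connected, so the curve \<open>g\<close> lifts to the covering from every starting
  point. Distinct lifts never meet, hence at each time they hit all \<open>N\<close> zeros.\<close>
lemma continuous_zero_curves:
  assumes f: "has_partials f f1 f2"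
    and fin: "\<And>x. finite {y. f x y = 0}" and card: "\<And>x. card {y. f x y = 0} \<le> N"
    and simple: "\<And>x y. card {y. f x y = 0} = N \<Longrightarrow> f x y = 0 \<Longrightarrow> f2 x y \<noteq> 0"
    and g: "continuous_on {0..} g" "\<And>t. t \<ge> (0::real) \<Longrightarrow> card {y. f (g t) y = 0} = N"
    and start: "bij_betw \<alpha> {..<N} {y. f (g 0) y = 0}"
  obtains ev where "\<And>r. r < N \<Longrightarrow> continuous_on {0..} (ev r)" "\<And>r. r < N \<Longrightarrow> ev r 0 = \<alpha> r"
    "\<And>t. t \<ge> 0 \<Longrightarrow> {y. f (g t) y = 0} = {ev r t | r. r < N}"
proof (cases "N = 0")
  case True
  have "{y. f (g t) y = 0} = {}" if "t \<ge> 0" for t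
    using g(2)[OF that] fin[of "g t"] unfolding True by (simp only: card_0_eq)
  then show ?thesis
    by (intro that[of "\<lambda>_ _. 0"]) (simp_all add: True)
next
  case False
  define D where "D = {x. card {y. f x y = 0} = N}"
  define C where "C = {z. fst z \<in> D \<and> f (fst z) (snd z) = 0}"
  have cov: "covering_space C fst D"
    unfolding C_def D_def
    by (rule zero_set_covering_space[OF f fin card _ simple]) (use False in simp_all)
  have gD: "g \<in> {0..} \<rightarrow> D" using g(2) by (auto simp: D_def)
  have "\<forall>r<N. \<exists>h. continuous_on {0..} h \<and> h \<in> {0..} \<rightarrow> C \<and> h 0 = (g 0, \<alpha> r) \<and>
      (\<forall>t\<in>{0..}. fst (h t) = g t)"
  proof (intro allI impI)
    fix r assume "r < N"
    then have "(g 0, \<alpha> r) \<in> C"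
      using start gD unfolding C_def bij_betw_def by auto
    then obtain h where "continuous_on {0..} h" "h \<in> {0..} \<rightarrow> C" "h 0 = (g 0, \<alpha> r)"
      "\<And>t. t \<in> {0..} \<Longrightarrow> fst (h t) = g t"
      using covering_space_lift_strong[OF cov, of "(g 0, \<alpha> r)" 0 "{0..}" g] g(1) gD
        convex_imp_simply_connected[of "{0::real..}"]
        convex_imp_locally_path_connected[of "{0::real..}"]
      by (auto simp: convex_real_interval)
    then show "\<exists>h. continuous_on {0..} h \<and> h \<in> {0..} \<rightarrow> C \<and> h 0 = (g 0, \<alpha> r) \<and>
      (\<forall>t\<in>{0..}. fst (h t) = g t)" by blast
  qed
  then obtain h where h: "\<And>r. r < N \<Longrightarrow> continuous_on {0..} (h r)"
    "\<And>r. r < N \<Longrightarrow> h r \<in> {0..} \<rightarrow> C" "\<And>r. r < N \<Longrightarrow> h r 0 = (g 0, \<alpha> r)"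
    "\<And>r t. r < N \<Longrightarrow> t \<ge> 0 \<Longrightarrow> fst (h r t) = g t"
    by (metis atLeast_iff)
  define ev where "ev = (\<lambda>r t. snd (h r t))"
  have inj: "inj_on (\<lambda>r. ev r t) {..<N}" if t: "t \<ge> 0" for t
  proof (rule inj_onI)
    fix r s assume rs: "r \<in> {..<N}" "s \<in> {..<N}" "ev r t = ev s t"
    then have eq: "h r t = h s t"
      using h(4) t by (auto simp: ev_def prod_eq_iff)
    have "h r 0 = h s 0"
      by (rule covering_space_lift_unique[OF cov, of "h r" t "h s" "{0..}" g])
        (use h gD g rs t eq in \<open>auto simp: convex_connected convex_real_interval\<close>)
    then show "r = s"
      using h(3) rs start unfolding bij_betw_def inj_on_def by auto
  qed
  show ?thesis
  proof (rule that[of ev])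
    show "continuous_on {0..} (ev r)" "ev r 0 = \<alpha> r" if "r < N" for r
      using h(1,3)[OF that] by (auto simp: ev_def intro!: continuous_intros)
    fix t :: real assume t: "t \<ge> 0"
    have "(\<lambda>r. ev r t) ` {..<N} = {y. f (g t) y = 0}"
    proof (rule card_seteq[OF fin])
      show "(\<lambda>r. ev r t) ` {..<N} \<subseteq> {y. f (g t) y = 0}"
      proof (intro subsetI, elim imageE)
        fix y r assume r: "y = ev r t" "r \<in> {..<N}"
        then have "h r t \<in> C" "fst (h r t) = g t"
          using h(2)[of r] h(4)[of r t] t by auto
        then show "y \<in> {y. f (g t) y = 0}"
          using r(1) by (simp add: C_def ev_def)
      qed
      show "card {y. f (g t) y = 0} \<le> card ((\<lambda>r. ev r t) ` {..<N})"
        using card card_image[OF inj[OF t]] by simp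
    qed
    then show "{y. f (g t) y = 0} = {ev r t | r. r < N}" by auto
  qed
qed

section \<open>Bases and matrix representations\<close>

definition is_basis :: "'a::complex_inner_space set \<Rightarrow> 'a list \<Rightarrow> bool" where
  "is_basis K bs \<longleftrightarrow> distinct bs \<and> cvec.independent (set bs) \<and> cvec.span (set bs) = K"

definition coord :: "'a::complex_inner_space list \<Rightarrow> 'a \<Rightarrow> nat \<Rightarrow> complex" where
  "coord bs x i = cvec.representation (set bs) x (bs ! i)"

text \<open>Rectangular for different bases in domain and codomain, so that matrices of basis change are
  the representations of the identity, and similarity follows from functoriality.\<close>
definition mat_rep ::
    "'a::complex_inner_space list \<Rightarrow> 'a list \<Rightarrow> ('a \<Rightarrow> 'a) \<Rightarrow> complex mat" where
  "mat_rep bs cs T = Matrix.mat (length bs) (length cs) (\<lambda>(i, j). coord bs (T (cs ! j)) i)"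

lemma op_matrix_eq: "op_matrix K T = mat_rep (basis_list K) (basis_list K) T"
  by (simp add: op_matrix_def mat_rep_def coord_def Let_def)

lemma clinear_add: "clinear T \<Longrightarrow> T (x + y) = T x + T y"
  by (simp add: Vector_Spaces.linear_iff)

lemma clinear_scale: "clinear T \<Longrightarrow> T (c *\<^sub>C x) = c *\<^sub>C T x"
  by (simp add: Vector_Spaces.linear_iff)

lemma clinear_zero: "clinear T \<Longrightarrow> T 0 = 0"
  by (metis add_cancel_right_right clinear_add)

lemma clinear_sum: "clinear T \<Longrightarrow> T (\<Sum>i\<in>I. f i) = (\<Sum>i\<in>I. T (f i))"
  by (induction I rule: infinite_finite_induct) (simp_all add: clinear_zero clinear_add)

lemma clinearI:
  assumes "\<And>x y. T (x + y) = T x + T y" "\<And>c x. T (c *\<^sub>C x) = c *\<^sub>C T x"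
  shows "clinear T"
  using assms cvec.vector_space_axioms by (simp add: Vector_Spaces.linear_iff)

lemma is_basis_subspace: "is_basis K bs \<Longrightarrow> cvec.subspace K"
  unfolding is_basis_def by (metis cvec.subspace_span)

lemma is_basis_nth: "is_basis K bs \<Longrightarrow> i < length bs \<Longrightarrow> bs ! i \<in> K"
  unfolding is_basis_def by (metis cvec.span_base nth_mem)

lemma sum_set_eq_sum_nth:
  assumes "distinct bs"
  shows "(\<Sum>b\<in>set bs. f b) = (\<Sum>i<length bs. f (bs ! i))"
  by (rule sum.reindex_bij_betw[symmetric])
    (use assms in \<open>auto intro!: bij_betw_nth\<close>)

lemma basis_expansion:
  assumes "is_basis K bs" "x \<in> K"
  shows "x = (\<Sum>i<length bs. coord bs x i *\<^sub>C (bs ! i))"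
proof -
  have "(\<Sum>b\<in>set bs. cvec.representation (set bs) x b *\<^sub>C b) = x"
    using assms unfolding is_basis_def
    by (intro cvec.sum_representation_eq) auto
  then show ?thesis
    using assms unfolding is_basis_def coord_def by (simp add: sum_set_eq_sum_nth)
qed

lemma coord_add:
  "is_basis K bs \<Longrightarrow> x \<in> K \<Longrightarrow> y \<in> K \<Longrightarrow> coord bs (x + y) i = coord bs x i + coord bs y i"
  unfolding is_basis_def coord_def by (simp add: cvec.representation_add)

lemma coord_diff:
  "is_basis K bs \<Longrightarrow> x \<in> K \<Longrightarrow> y \<in> K \<Longrightarrow> coord bs (x - y) i = coord bs x i - coord bs y i"
  unfolding is_basis_def coord_def by (simp add: cvec.representation_diff)

lemma coord_scale:
  "is_basis K bs \<Longrightarrow> x \<in> K \<Longrightarrow> coord bs (c *\<^sub>C x) i = c * coord bs x i"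
  unfolding is_basis_def coord_def by (simp add: cvec.representation_scale)

lemma coord_zero [simp]: "coord bs 0 i = 0"
  unfolding coord_def by (simp add: cvec.representation_zero)

lemma coord_sum:
  assumes "is_basis K bs" "\<And>j. j \<in> J \<Longrightarrow> f j \<in> K"
  shows "coord bs (\<Sum>j\<in>J. f j) i = (\<Sum>j\<in>J. coord bs (f j) i)"
  using assms(2)
proof (induction J rule: infinite_finite_induct)
  case (insert j J)
  then show ?case
    using cvec.subspace_sum[OF is_basis_subspace[OF assms(1)], of J f]
    by (simp add: coord_add[OF assms(1)])
qed auto

lemma coord_nth:
  assumes "is_basis K bs" "i < length bs" "j < length bs"
  shows "coord bs (bs ! j) i = (if i = j then 1 else 0)"
  using assms unfolding is_basis_def coord_def
  by (simp add: cvec.representation_basis nth_eq_iff_index_eq)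

lemma coord_combination:
  assumes "is_basis K bs" "i < length bs"
  shows "coord bs (\<Sum>j<length bs. c j *\<^sub>C (bs ! j)) i = c i"
proof -
  have mem: "c j *\<^sub>C (bs ! j) \<in> K" if "j < length bs" for j
    using is_basis_nth[OF assms(1) that] is_basis_subspace[OF assms(1)]
    by (simp add: cvec.subspace_scale)
  have "coord bs (\<Sum>j<length bs. c j *\<^sub>C (bs ! j)) i = (\<Sum>j<length bs. coord bs (c j *\<^sub>C (bs ! j)) i)"
    by (rule coord_sum[OF assms(1)]) (use mem in auto)
  also have "\<dots> = (\<Sum>j<length bs. if i = j then c j else 0)"
    using is_basis_nth[OF assms(1)]
    by (intro sum.cong) (auto simp: coord_scale[OF assms(1)] coord_nth[OF assms(1,2)])
  also have "\<dots> = c i" using assms(2) by simp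
  finally show ?thesis .
qed

lemma coord_eqI:
  assumes "is_basis K bs" "x \<in> K" "y \<in> K" "\<And>i. i < length bs \<Longrightarrow> coord bs x i = coord bs y i"
  shows "x = y"
  using basis_expansion[OF assms(1,2)] basis_expansion[OF assms(1,3)] assms(4)
  by (metis (no_types, lifting) lessThan_iff sum.cong)

lemma basis_list_is_basis:
  fixes K :: "'a::complex_inner_space set"
  assumes fd: "\<exists>S :: 'a set. finite S \<and> cvec.span S = UNIV" and K: "cvec.subspace K"
  shows "is_basis K (basis_list K)"
proof -
  obtain S :: "'a set" where S: "finite S" "cvec.span S = UNIV" using fd by auto
  obtain B where B: "B \<subseteq> K" "cvec.independent B" "K \<subseteq> cvec.span B"
    using cvec.basis_exists[of K] by metis
  have "finite B"
    using cvec.independent_span_bound[OF S(1) B(2)] S(2) by auto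
  then obtain vs where vs: "set vs = B" "distinct vs"
    using finite_distinct_list by metis
  have "cvec.span B = K"
    using B K by (metis cvec.span_subspace)
  then have "\<exists>vs. distinct vs \<and> cvec.independent (set vs) \<and> cvec.span (set vs) = K"
    using vs B by auto
  then show ?thesis
    unfolding is_basis_def basis_list_def by (rule someI_ex)
qed

lemma length_basis: "is_basis K bs \<Longrightarrow> length bs = cvec.dim K"
  unfolding is_basis_def
  by (metis cvec.dim_eq_card_independent cvec.dim_span distinct_card)

lemma mat_rep_compose:
  assumes b: "is_basis UNIV bs" and c: "is_basis UNIV cs" and S: "clinear S"
  shows "mat_rep bs ds (\<lambda>x. S (T x)) = mat_rep bs cs S * mat_rep cs ds T"
proof (rule eq_matI)
  fix i j assume ij: "i < dim_row (mat_rep bs cs S * mat_rep cs ds T)"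
    "j < dim_col (mat_rep bs cs S * mat_rep cs ds T)"
  then have ij': "i < length bs" "j < length ds" by (auto simp: mat_rep_def)
  have "coord bs (S (T (ds ! j))) i =
      coord bs (S (\<Sum>k<length cs. coord cs (T (ds ! j)) k *\<^sub>C (cs ! k))) i"
    using basis_expansion[OF c, of "T (ds ! j)"] by simp
  also have "\<dots> = (\<Sum>k<length cs. coord bs (S (cs ! k)) i * coord cs (T (ds ! j)) k)"
    by (simp add: clinear_sum[OF S] clinear_scale[OF S] coord_sum[OF b] coord_scale[OF b] mult.commute)
  finally show "mat_rep bs ds (\<lambda>x. S (T x)) $$ (i, j) = (mat_rep bs cs S * mat_rep cs ds T) $$ (i, j)"
    using ij' by (simp add: mat_rep_def scalar_prod_def atLeast0LessThan)
qed (auto simp: mat_rep_def)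

lemma mat_rep_id: "is_basis K bs \<Longrightarrow> mat_rep bs bs (\<lambda>x. x) = 1\<^sub>m (length bs)"
  by (rule eq_matI) (auto simp: mat_rep_def coord_nth)

lemma mat_rep_similar:
  assumes b: "is_basis UNIV bs" and c: "is_basis UNIV cs" and T: "clinear T"
  shows "similar_mat (mat_rep bs bs T) (mat_rep cs cs T)"
proof -
  have id: "clinear (\<lambda>x. x)" by (rule clinearI) auto
  have len: "length bs = length cs"
    using length_basis b c by metis
  show ?thesis
  proof (rule similar_matI)
    show "{mat_rep bs bs T, mat_rep cs cs T, mat_rep bs cs (\<lambda>x. x), mat_rep cs bs (\<lambda>x. x)}
        \<subseteq> carrier_mat (length bs) (length bs)"
      by (auto simp: mat_rep_def len)
    show "mat_rep bs cs (\<lambda>x. x) * mat_rep cs bs (\<lambda>x. x) = 1\<^sub>m (length bs)"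
      using mat_rep_compose[OF b c id, of bs "\<lambda>x. x"] mat_rep_id[OF b] by simp
    show "mat_rep cs bs (\<lambda>x. x) * mat_rep bs cs (\<lambda>x. x) = 1\<^sub>m (length bs)"
      using mat_rep_compose[OF c b id, of cs "\<lambda>x. x"] mat_rep_id[OF c] len by simp
    show "mat_rep bs bs T = mat_rep bs cs (\<lambda>x. x) * mat_rep cs cs T * mat_rep cs bs (\<lambda>x. x)"
      using mat_rep_compose[OF b c id, of cs T] mat_rep_compose[OF b c T, of bs "\<lambda>x. x"] by simp
  qed
qed

lemma spec_on_iff_char_poly:
  assumes b: "is_basis K bs" and T: "clinear T" and inv: "\<And>x. x \<in> K \<Longrightarrow> T x \<in> K"
  shows "l \<in> spec_on K T \<longleftrightarrow> poly (char_poly (mat_rep bs bs T)) l = 0"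
proof -
  define n where "n = length bs"
  define M where "M = mat_rep bs bs T"
  have M: "M \<in> carrier_mat n n" by (simp add: M_def mat_rep_def n_def)
  have app: "(M *\<^sub>v v) $ i = coord bs (T (\<Sum>j<n. (v $ j) *\<^sub>C (bs ! j))) i"
    if "v \<in> carrier_vec n" "i < n" for v i
  proof -
    have "coord bs (T (\<Sum>j<n. (v $ j) *\<^sub>C (bs ! j))) i = (\<Sum>j<n. coord bs (T (bs ! j)) i * v $ j)"
      using is_basis_nth[OF b] inv cvec.subspace_scale[OF is_basis_subspace[OF b]]
      unfolding clinear_sum[OF T] clinear_scale[OF T] n_def
      by (subst coord_sum[OF b]) (auto simp: coord_scale[OF b] mult.commute)
    then show ?thesis
      using that unfolding M_def mat_rep_def
      by (simp add: scalar_prod_def atLeast0LessThan n_def)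
  qed
  have mem: "(\<Sum>j<n. c j *\<^sub>C (bs ! j)) \<in> K" for c
    using is_basis_nth[OF b] is_basis_subspace[OF b]
    by (auto intro!: cvec.subspace_sum cvec.subspace_scale simp: n_def)
  have "l \<in> spec_on K T \<longleftrightarrow> eigenvalue M l"
  proof
    assume "l \<in> spec_on K T"
    then obtain x where x: "x \<in> K" "x \<noteq> 0" "T x = l *\<^sub>C x" unfolding spec_on_def by auto
    define v where "v = vec n (coord bs x)"
    have sum: "(\<Sum>j<n. (v $ j) *\<^sub>C (bs ! j)) = x"
      using basis_expansion[OF b x(1)] by (simp add: v_def n_def)
    have "v \<noteq> 0\<^sub>v n"
    proof
      assume "v = 0\<^sub>v n"
      then have "(\<Sum>j<n. (v $ j) *\<^sub>C (bs ! j)) = 0" by simp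
      then show False using sum x(2) by simp
    qed
    moreover have "M *\<^sub>v v = l \<cdot>\<^sub>v v"
    proof (rule eq_vecI)
      fix i assume "i < dim_vec (l \<cdot>\<^sub>v v)"
      then have i: "i < n" by (simp add: v_def)
      show "(M *\<^sub>v v) $ i = (l \<cdot>\<^sub>v v) $ i"
        using app[of v i] i x unfolding sum
        by (simp add: v_def coord_scale[OF b])
    qed (use M in \<open>auto simp: v_def\<close>)
    ultimately show "eigenvalue M l"
      using M unfolding eigenvalue_def eigenvector_def by (intro exI[of _ v]) (auto simp: v_def)
  next
    assume "eigenvalue M l"
    then obtain v where v: "v \<in> carrier_vec n" "v \<noteq> 0\<^sub>v n" "M *\<^sub>v v = l \<cdot>\<^sub>v v"
      using M unfolding eigenvalue_def eigenvector_def by auto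
    define x where "x = (\<Sum>j<n. (v $ j) *\<^sub>C (bs ! j))"
    have xK: "x \<in> K" unfolding x_def by (rule mem)
    have cx: "coord bs x i = v $ i" if "i < n" for i
      using coord_combination[OF b, of i "\<lambda>j. v $ j"] that by (simp add: x_def n_def)
    have "x \<noteq> 0"
    proof
      assume "x = 0"
      then have "v = 0\<^sub>v n"
        using cx v(1) by (intro eq_vecI) auto
      then show False using v(2) by simp
    qed
    moreover have "T x = l *\<^sub>C x"
    proof (rule coord_eqI[OF b inv[OF xK]])
      show "l *\<^sub>C x \<in> K" using xK is_basis_subspace[OF b] by (simp add: cvec.subspace_scale)
      fix i assume "i < length bs"
      then show "coord bs (T x) i = coord bs (l *\<^sub>C x) i"
        using app[OF v(1), of i, folded x_def] cx[of i] v(1,3) xK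
        by (simp add: coord_scale[OF b] n_def)
    qed
    ultimately show "l \<in> spec_on K T" using xK unfolding spec_on_def by auto
  qed
  then show ?thesis
    using eigenvalue_root_char_poly[OF M] by (simp add: M_def)
qed

section \<open>Orthogonal decompositions\<close>

lemma cinner_add_right: "cinner x (y + z) = cinner x y + cinner x z"
  by (metis cinner_add_left cinner_commute complex_cnj_add)

lemma cinner_scaleC_right: "cinner x (c *\<^sub>C y) = cnj c * cinner x y"
  by (metis cinner_commute cinner_scaleC_left complex_cnj_mult)

lemma cinner_zero_left [simp]: "cinner 0 x = 0"
  by (metis cinner_scaleC_left cvec.scale_zero_left mult_zero_left)

lemma cinner_zero_right [simp]: "cinner x 0 = 0"
  by (metis cinner_commute cinner_zero_left complex_cnj_zero)

lemma cinner_minus_left: "cinner (- x) y = - cinner x y"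
  by (metis add.right_inverse cinner_add_left cinner_zero_left neg_eq_iff_add_eq_0)

lemma cinner_diff_left: "cinner (x - y) z = cinner x z - cinner y z"
  by (metis cinner_add_left cinner_minus_left diff_conv_add_uminus)

lemma cinner_self_eq_0: "cinner x x = 0 \<Longrightarrow> x = 0"
  using cinner_pos by force

lemma Im_cinner_self [simp]: "Im (cinner x x) = 0"
  using arg_cong[OF cinner_commute[of x x], of Im] by simp

lemma orth_commute: "cinner x y = 0 \<longleftrightarrow> cinner y x = 0"
  by (metis cinner_commute complex_cnj_zero)

lemma orth_complement_subspace: "cvec.subspace {x. \<forall>z\<in>K. cinner x z = 0}"
  by (rule cvec.subspaceI) (auto simp: cinner_add_left cinner_scaleC_left)

lemma orth_span:
  assumes "\<And>s. s \<in> S \<Longrightarrow> cinner x s = 0" "z \<in> cvec.span S"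
  shows "cinner x z = 0"
  using assms(2)
  by (induction rule: cvec.span_induct_alt)
    (auto simp: cinner_add_right cinner_scaleC_right assms(1))

text \<open>One step of the Gram-Schmidt process: the new vector \<open>a\<close> is replaced by its component \<open>a'\<close>
  orthogonal to the previous span, and the component of \<open>x\<close> along \<open>a'\<close> is added to the
  projection.\<close>
lemma orth_decomposition_span:
  assumes "finite S"
  shows "\<exists>y\<in>cvec.span S. \<forall>z\<in>cvec.span S. cinner (x - y) z = 0"
  using assms
proof (induction S arbitrary: x rule: finite_induct)
  case empty
  then show ?case by (auto simp: cvec.span_empty)
next
  case (insert a S)
  obtain p where p: "p \<in> cvec.span S" "\<And>z. z \<in> cvec.span S \<Longrightarrow> cinner (a - p) z = 0"
    using insert.IH[of a] by auto
  obtain y where y: "y \<in> cvec.span S" "\<And>z. z \<in> cvec.span S \<Longrightarrow> cinner (x - y) z = 0"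
    using insert.IH[of x] by auto
  define a' where "a' = a - p"
  define c where "c = cinner (x - y) a' / cinner a' a'"
  have S_sub: "cvec.span S \<subseteq> cvec.span (insert a S)"
    by (rule cvec.span_mono) auto
  have a': "a' \<in> cvec.span (insert a S)"
    unfolding a'_def using p(1) S_sub by (intro cvec.span_diff[OF cvec.span_base]) blast+
  have o1: "cinner (x - (y + c *\<^sub>C a')) z = 0" if "z \<in> cvec.span S" for z
    using y(2)[OF that] p(2)[OF that] unfolding a'_def[symmetric]
    by (simp add: cinner_diff_left cinner_add_left cinner_scaleC_left algebra_simps)
  have o2: "cinner (x - (y + c *\<^sub>C a')) a' = 0"
  proof (cases "a' = 0")
    case False
    then have "cinner a' a' \<noteq> 0" using cinner_self_eq_0 by blast
    then show ?thesis
      unfolding c_def by (simp add: cinner_diff_left cinner_add_left cinner_scaleC_left)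
  qed simp
  have "cinner (x - (y + c *\<^sub>C a')) a = 0"
  proof -
    have "a = a' + p" by (simp add: a'_def)
    then show ?thesis using o1[OF p(1)] o2 by (metis add_0 cinner_add_right)
  qed
  then have "cinner (x - (y + c *\<^sub>C a')) z = 0" if "z \<in> cvec.span (insert a S)" for z
    using orth_span[of "insert a S", OF _ that] o1 cvec.span_base by blast
  moreover have "y + c *\<^sub>C a' \<in> cvec.span (insert a S)"
    using a' y(1) S_sub by (auto intro!: cvec.span_add cvec.span_scale)
  ultimately show ?case by blast
qed

lemma orth_decomposition:
  fixes K :: "'a::complex_inner_space set"
  assumes fd: "\<exists>S :: 'a set. finite S \<and> cvec.span S = UNIV" and K: "cvec.subspace K"
  obtains y where "y \<in> K" "\<And>z. z \<in> K \<Longrightarrow> cinner (x - y) z = 0"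
  using orth_decomposition_span[of "set (basis_list K)" x] basis_list_is_basis[OF fd K]
  unfolding is_basis_def by auto

lemma orth_proj_unique:
  assumes K: "cvec.subspace K" and "y \<in> K" "\<And>z. z \<in> K \<Longrightarrow> cinner (x - y) z = 0"
  shows "orth_proj K x = y"
  unfolding orth_proj_def
proof (rule the_equality)
  fix w assume w: "w \<in> K \<and> (\<forall>z\<in>K. cinner (x - w) z = 0)"
  then have "y - w \<in> K" using assms by (simp add: cvec.subspace_diff)
  then have "cinner (x - w) (y - w) - cinner (x - y) (y - w) = 0"
    using w assms(3) by simp
  then have "cinner (y - w) (y - w) = 0"
    by (simp add: cinner_diff_left)
  then show "w = y" using cinner_self_eq_0 by fastforce
qed (use assms in auto)

lemma orth_proj_props:
  fixes K :: "'a::complex_inner_space set"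
  assumes fd: "\<exists>S :: 'a set. finite S \<and> cvec.span S = UNIV" and K: "cvec.subspace K"
  shows "orth_proj K x \<in> K" and "z \<in> K \<Longrightarrow> cinner (x - orth_proj K x) z = 0"
    and "clinear (orth_proj K)" and "x \<in> K \<Longrightarrow> orth_proj K x = x"
proof -
  have *: "orth_proj K x \<in> K \<and> (\<forall>z\<in>K. cinner (x - orth_proj K x) z = 0)" for x
    using orth_decomposition[OF fd K, of x] orth_proj_unique[OF K] by metis
  show "orth_proj K x \<in> K" "z \<in> K \<Longrightarrow> cinner (x - orth_proj K x) z = 0"
    using * by auto
  show "x \<in> K \<Longrightarrow> orth_proj K x = x"
    by (rule orth_proj_unique[OF K]) auto
  show "clinear (orth_proj K)"
  proof (rule clinearI)
    fix x y c
    show "orth_proj K (x + y) = orth_proj K x + orth_proj K y"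
    proof (rule orth_proj_unique[OF K])
      show "orth_proj K x + orth_proj K y \<in> K" using * K by (simp add: cvec.subspace_add)
      fix z assume "z \<in> K"
      then have "cinner (x - orth_proj K x) z = 0" "cinner (y - orth_proj K y) z = 0"
        using * by auto
      then show "cinner (x + y - (orth_proj K x + orth_proj K y)) z = 0"
        by (simp add: cinner_diff_left cinner_add_left algebra_simps)
    qed
    show "orth_proj K (c *\<^sub>C x) = c *\<^sub>C orth_proj K x"
    proof (rule orth_proj_unique[OF K])
      show "c *\<^sub>C orth_proj K x \<in> K" using * K by (simp add: cvec.subspace_scale)
      fix z assume "z \<in> K"
      then have "cinner (x - orth_proj K x) z = 0" using * by auto
      then show "cinner (c *\<^sub>C x - c *\<^sub>C orth_proj K x) z = 0"
        by (simp add: cinner_diff_left cinner_scaleC_left algebra_simps)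
    qed
  qed
qed

lemma basis_append:
  fixes us vs :: "'a::complex_inner_space list"
  assumes u: "is_basis U us" and v: "is_basis V vs"
    and orth: "\<And>u v. u \<in> U \<Longrightarrow> v \<in> V \<Longrightarrow> cinner u v = 0"
    and sum: "\<And>x. \<exists>u\<in>U. \<exists>v\<in>V. x = u + v"
  shows "is_basis UNIV (us @ vs)"
proof -
  have U: "cvec.subspace U" "cvec.span (set us) = U" "set us \<subseteq> U" "distinct us"
      "cvec.independent (set us)"
    using u cvec.span_superset unfolding is_basis_def by auto
  have V: "cvec.subspace V" "cvec.span (set vs) = V" "set vs \<subseteq> V" "distinct vs"
      "cvec.independent (set vs)"
    using v cvec.span_superset unfolding is_basis_def by auto
  have disj: "set us \<inter> set vs = {}"
  proof (rule ccontr)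
    assume "set us \<inter> set vs \<noteq> {}"
    then obtain x where x: "x \<in> set us" "x \<in> set vs" by auto
    then have "x = 0" using orth U(3) V(3) cinner_self_eq_0 by blast
    then show False using x U(5) cvec.dependent_zero by blast
  qed
  have "cvec.independent (set us \<union> set vs)"
  proof (rule cvec.independent_if_scalars_zero)
    fix f x assume f: "(\<Sum>x\<in>set us \<union> set vs. f x *\<^sub>C x) = 0" and x: "x \<in> set us \<union> set vs"
    define p where "p = (\<Sum>x\<in>set us. f x *\<^sub>C x)"
    define q where "q = (\<Sum>x\<in>set vs. f x *\<^sub>C x)"
    have pq: "p + q = 0" using f disj unfolding p_def q_def by (simp add: sum.union_disjoint)
    have p: "p \<in> U" unfolding p_def using U(1,3) by (auto intro!: cvec.subspace_sum cvec.subspace_scale)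
    have q: "q \<in> V" unfolding q_def using V(1,3) by (auto intro!: cvec.subspace_sum cvec.subspace_scale)
    have "cinner p p + cinner q p = 0" using pq by (metis cinner_add_left cinner_zero_left)
    then have "cinner p p = 0" using orth[OF p q] orth_commute[of p q] by simp
    then have p0: "p = 0" by (rule cinner_self_eq_0)
    then have q0: "q = 0" using pq by simp
    show "f x = 0"
      using x cvec.independentD[OF U(5) _ _ p0[unfolded p_def], of x]
        cvec.independentD[OF V(5) _ _ q0[unfolded q_def], of x] by auto
  qed auto
  moreover have "cvec.span (set us \<union> set vs) = UNIV"
    using sum unfolding cvec.span_Un U(2) V(2) by blast
  ultimately show ?thesis
    using disj U(4) V(4) by (simp add: is_basis_def)
qed

lemma coord_append:
  assumes u: "is_basis U us" and v: "is_basis V vs" and uv: "is_basis UNIV (us @ vs)"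
    and "x \<in> U" "y \<in> V"
  shows "i < length us \<Longrightarrow> coord (us @ vs) (x + y) i = coord us x i"
    and "i < length vs \<Longrightarrow> coord (us @ vs) (x + y) (length us + i) = coord vs y i"
proof -
  define c where "c = (\<lambda>i. if i < length us then coord us x i else coord vs y (i - length us))"
  have "x + y = (\<Sum>i<length us. c i *\<^sub>C ((us @ vs) ! i)) +
      (\<Sum>i<length vs. c (length us + i) *\<^sub>C ((us @ vs) ! (length us + i)))"
    using basis_expansion[OF u \<open>x \<in> U\<close>] basis_expansion[OF v \<open>y \<in> V\<close>]
    by (simp add: c_def nth_append)
  also have "\<dots> = (\<Sum>i<length (us @ vs). c i *\<^sub>C ((us @ vs) ! i))"
    using sum.atLeastLessThan_concat[of 0 "length us" "length us + length vs"
        "\<lambda>i. c i *\<^sub>C ((us @ vs) ! i)"]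
      sum.shift_bounds_nat_ivl[of "\<lambda>i. c i *\<^sub>C ((us @ vs) ! i)" 0 "length us" "length vs"]
    by (simp add: atLeast0LessThan add.commute)
  finally have eq: "x + y = (\<Sum>i<length (us @ vs). c i *\<^sub>C ((us @ vs) ! i))" .
  have co: "coord (us @ vs) (x + y) i = c i" if "i < length (us @ vs)" for i
    unfolding eq by (rule coord_combination[OF uv that])
  show "i < length us \<Longrightarrow> coord (us @ vs) (x + y) i = coord us x i"
    using co[of i] by (simp add: c_def)
  show "i < length vs \<Longrightarrow> coord (us @ vs) (x + y) (length us + i) = coord vs y i"
    using co[of "length us + i"] by (simp add: c_def)
qed

section \<open>Sectorial operators\<close>

lemma real_quadratic_nonneg_imp_linear_zero:
  fixes a k :: real
  assumes "\<And>s. 0 \<le> s * a + s\<^sup>2 * k"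
  shows "a = 0"
proof (rule ccontr)
  assume "a \<noteq> 0"
  define d where "d = \<bar>k\<bar> + 1"
  have d: "d > 0" "k < d" by (auto simp: d_def)
  have "0 \<le> - a / d * a + (- a / d)\<^sup>2 * k" by (rule assms)
  also have "\<dots> = a\<^sup>2 / d\<^sup>2 * (k - d)"
    using d by (simp add: field_simps power2_eq_square)
  also have "\<dots> < 0"
    using d \<open>a \<noteq> 0\<close> by (intro mult_pos_neg) auto
  finally show False by simp
qed

text \<open>The two half-planes are chosen so that the intersection of their boundary lines is the origin.
  Together they suffice to show that a vector with vanishing form is annihilated by the operator and
  its adjoint. The two edges of the sector would not do, since they may lie on one line.\<close>
lemma sectorial_half_planes:
  assumes "sectorial B \<sigma>\<^sub>1 \<sigma>\<^sub>2"
  shows "Re (cinner (B f) f) \<ge> 0" "Im (cis \<sigma>\<^sub>1 * cinner (B f) f) \<ge> 0"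
proof -
  define z where "z = cinner (B f) f"
  have s: "- pi / 2 < - \<sigma>\<^sub>1" "0 \<le> \<sigma>\<^sub>1" "0 \<le> \<sigma>\<^sub>2" "\<sigma>\<^sub>2 < pi / 2"
    and z: "z = 0 \<or> (- \<sigma>\<^sub>1 \<le> Arg z \<and> Arg z \<le> \<sigma>\<^sub>2)"
    using assms unfolding sectorial_def z_def by auto
  have "Re z \<ge> 0 \<and> Im (cis \<sigma>\<^sub>1 * z) \<ge> 0"
  proof (cases "z = 0")
    case False
    then have a: "- \<sigma>\<^sub>1 \<le> Arg z" "Arg z \<le> \<sigma>\<^sub>2" using z by auto
    have zz: "z = rcis (cmod z) (Arg z)" by (simp add: rcis_cmod_Arg)
    have "Re z = cmod z * cos (Arg z)" by (metis zz Re_rcis)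
    moreover have "cos (Arg z) \<ge> 0" using a s by (intro cos_ge_zero) auto
    moreover have "cis \<sigma>\<^sub>1 * z = rcis (cmod z) (\<sigma>\<^sub>1 + Arg z)"
      by (subst zz) (simp add: rcis_def cis_mult mult.left_commute)
    moreover have "sin (\<sigma>\<^sub>1 + Arg z) \<ge> 0" using a s by (intro sin_ge_zero) auto
    ultimately show ?thesis by simp
  qed simp
  then show "Re (cinner (B f) f) \<ge> 0" "Im (cis \<sigma>\<^sub>1 * cinner (B f) f) \<ge> 0"
    by (simp_all add: z_def)
qed

text \<open>At a vector \<open>f\<close> with vanishing form, the form on the line \<open>f + s w\<close> is \<open>s L(w) + O(s\<^sup>2)\<close> and
  never leaves the two half-planes; so \<open>L(w)\<close> lies on both boundary lines, that is,
  \<open>L(w) = 0\<close>. The second claim says that the adjoint of \<open>B\<close> annihilates \<open>f\<close>.\<close>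
lemma sectorial_form_zero:
  assumes B: "sectorial B \<sigma>\<^sub>1 \<sigma>\<^sub>2" and f: "cinner (B f) f = 0"
  shows "B f = 0" and "cinner (B w) f = 0"
proof -
  have lin: "clinear B" and s1: "\<sigma>\<^sub>1 < pi / 2" "0 \<le> \<sigma>\<^sub>1"
    using B unfolding sectorial_def by auto
  define L where "L = (\<lambda>w. cinner (B w) f + cinner (B f) w)"
  have expand: "cinner (B (f + complex_of_real s *\<^sub>C w)) (f + complex_of_real s *\<^sub>C w) =
      complex_of_real s * L w + complex_of_real (s\<^sup>2) * cinner (B w) w" for s w
    using f by (simp add: L_def clinear_add[OF lin] clinear_scale[OF lin] cinner_add_left
        cinner_add_right cinner_scaleC_left cinner_scaleC_right power2_eq_square algebra_simps)
  have Im_real_mult: "Im (complex_of_real r * z) = r * Im z" for r z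
    by simp
  have L0: "L w = 0" for w
  proof -
    have "Re (L w) = 0"
    proof (rule real_quadratic_nonneg_imp_linear_zero)
      fix s
      show "0 \<le> s * Re (L w) + s\<^sup>2 * Re (cinner (B w) w)"
        using sectorial_half_planes(1)[OF B, of "f + complex_of_real s *\<^sub>C w"]
        unfolding expand by simp
    qed
    moreover have "Im (cis \<sigma>\<^sub>1 * L w) = 0"
    proof (rule real_quadratic_nonneg_imp_linear_zero)
      fix s
      have "cis \<sigma>\<^sub>1 * (complex_of_real s * L w + complex_of_real (s\<^sup>2) * cinner (B w) w) =
          complex_of_real s * (cis \<sigma>\<^sub>1 * L w) + complex_of_real (s\<^sup>2) * (cis \<sigma>\<^sub>1 * cinner (B w) w)"
        by (simp add: algebra_simps)
      then show "0 \<le> s * Im (cis \<sigma>\<^sub>1 * L w) + s\<^sup>2 * Im (cis \<sigma>\<^sub>1 * cinner (B w) w)"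
        using sectorial_half_planes(2)[OF B, of "f + complex_of_real s *\<^sub>C w"]
        unfolding expand by (simp only: Im_real_mult plus_complex.sel)
    qed
    moreover have "cos \<sigma>\<^sub>1 > 0" using s1 by (intro cos_gt_zero_pi) auto
    ultimately show "L w = 0" by (simp add: complex_eq_iff)
  qed
  \<comment> \<open>\<open>L\<close> is the sum of a linear and an antilinear functional of \<open>w\<close>, so \<open>L = 0\<close> makes both vanish.\<close>
  have "L (\<i> *\<^sub>C w) = \<i> * (cinner (B w) f - cinner (B f) w)" for w
    by (simp add: L_def clinear_scale[OF lin] cinner_scaleC_left cinner_scaleC_right algebra_simps)
  then have "cinner (B w) f = cinner (B f) w" for w
    using L0[of "\<i> *\<^sub>C w"] by simp
  then have both: "cinner (B w) f = 0 \<and> cinner (B f) w = 0" for w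
    using L0[of w] by (simp add: L_def)
  show "B f = 0" using both[of "B f"] cinner_self_eq_0 by blast
  show "cinner (B w) f = 0" using both by blast
qed

lemma sector_form_upper_half_plane:
  assumes B: "sectorial B \<sigma>\<^sub>1 \<sigma>\<^sub>2" and g: "\<gamma> \<in> sector \<sigma>\<^sub>1 \<sigma>\<^sub>2" "\<gamma> \<noteq> 0"
    and f: "cinner (B f) f \<noteq> 0"
  shows "Im (\<gamma> * cinner (B f) f) > 0"
proof -
  define z where "z = cinner (B f) f"
  have z: "z \<noteq> 0" "- \<sigma>\<^sub>1 \<le> Arg z" "Arg z \<le> \<sigma>\<^sub>2"
    using B f unfolding sectorial_def z_def by auto
  have g': "\<sigma>\<^sub>1 < Arg \<gamma>" "Arg \<gamma> < pi - \<sigma>\<^sub>2" using g unfolding sector_def by auto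
  have "\<gamma> * z = rcis (cmod \<gamma> * cmod z) (Arg \<gamma> + Arg z)"
    using rcis_cmod_Arg[of z] rcis_cmod_Arg[of \<gamma>] by (metis rcis_mult)
  moreover have "sin (Arg \<gamma> + Arg z) > 0"
    using z g' by (intro sin_gt_zero) auto
  ultimately show ?thesis using z(1) g(2) by (simp add: z_def)
qed

text \<open>Otherwise \<open>f\<close> is an eigenvector of the symmetric operator \<open>A\<close> orthogonal to the range of \<open>B\<close>,
  hence to all \<open>A\<^sup>n B v\<close>, and cyclicity makes it zero. The statement includes \<open>\<gamma> = 0\<close>, which is needed for the initial
  velocities of the eigenvalues.\<close>
lemma eigenvector_form_nonzero:
  assumes A: "self_adjoint A" and B: "sectorial B \<sigma>\<^sub>1 \<sigma>\<^sub>2" and cyc: "cyclic_for B A"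
    and f: "perturbed A B \<gamma> f = l *\<^sub>C f" "f \<noteq> 0"
  shows "cinner (B f) f \<noteq> 0"
proof
  assume zero: "cinner (B f) f = 0"
  note Bf = sectorial_form_zero[OF B zero]
  have Af: "A f = l *\<^sub>C f" using f(1) Bf(1) by (simp add: perturbed_def)
  have "cinner ((A ^^ n) (B v)) f = 0" for n v
  proof (induction n)
    case (Suc n)
    have "cinner ((A ^^ Suc n) (B v)) f = cinner ((A ^^ n) (B v)) (A f)"
      using A unfolding self_adjoint_def by simp
    then show ?case using Suc by (simp add: Af cinner_scaleC_right)
  qed (simp add: Bf(2))
  then have "cinner f f = 0"
    using cyc unfolding cyclic_for_def
    by (intro orth_span[of "{(A ^^ n) (B v) |n v. True}" f f]) (auto simp: orth_commute[of f])
  then show False using f(2) cinner_self_eq_0 by blast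
qed

lemma symmetric_spec_real:
  assumes "\<And>x y. x \<in> K \<Longrightarrow> y \<in> K \<Longrightarrow> cinner (T x) y = cinner x (T y)" "l \<in> spec_on K T"
  shows "Im l = 0"
proof -
  obtain x where x: "x \<in> K" "x \<noteq> 0" "T x = l *\<^sub>C x" using assms(2) unfolding spec_on_def by auto
  have "l * cinner x x = cnj l * cinner x x"
    using assms(1)[OF x(1,1)] x(3) by (simp add: cinner_scaleC_left cinner_scaleC_right)
  then have "l = cnj l" using x(2) cinner_self_eq_0 by auto
  then show ?thesis by (simp add: complex_eq_iff)
qed

text \<open>Imaginary parts in \<open>l \<langle>f, f\<rangle> = \<langle>Af, f\<rangle> + \<gamma> \<langle>Bf, f\<rangle>\<close>, where \<open>\<langle>Af, f\<rangle>\<close> is real.\<close>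
lemma perturbed_spec_upper_half_plane:
  assumes A: "self_adjoint A" and B: "sectorial B \<sigma>\<^sub>1 \<sigma>\<^sub>2" and cyc: "cyclic_for B A"
    and g: "\<gamma> \<in> sector \<sigma>\<^sub>1 \<sigma>\<^sub>2" "\<gamma> \<noteq> 0" and l: "l \<in> Spec (perturbed A B \<gamma>)"
  shows "Im l > 0"
proof -
  obtain f where f: "f \<noteq> 0" "perturbed A B \<gamma> f = l *\<^sub>C f" using l unfolding spec_on_def by auto
  have "cinner (A f) f = cnj (cinner (A f) f)"
    using A cinner_commute unfolding self_adjoint_def by metis
  then have "Im (cinner (A f) f) = 0" by (simp add: complex_eq_iff)
  moreover have "l * cinner f f = cinner (A f) f + \<gamma> * cinner (B f) f"
    using arg_cong[OF f(2), of "\<lambda>x. cinner x f"]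
    by (simp add: perturbed_def cinner_add_left cinner_scaleC_left)
  then have "Im (l * cinner f f) = Im (cinner (A f) f + \<gamma> * cinner (B f) f)" by simp
  ultimately have "Im l * Re (cinner f f) = Im (\<gamma> * cinner (B f) f)" by simp
  moreover have "\<dots> > 0"
    by (rule sector_form_upper_half_plane[OF B g eigenvector_form_nonzero[OF A B cyc f(2,1)]])
  ultimately show ?thesis
    using cinner_pos[OF f(1)] by (metis zero_less_mult_pos2)
qed

section \<open>Determinants of structured matrices\<close>

abbreviation mdet :: "nat \<Rightarrow> (nat \<Rightarrow> nat \<Rightarrow> complex) \<Rightarrow> complex" where
  "mdet n m \<equiv> Determinant.det (Matrix.mat n n (\<lambda>(i, j). m i j))"

lemma mdet_cong: "(\<And>i j. i < n \<Longrightarrow> j < n \<Longrightarrow> m i j = m' i j) \<Longrightarrow> mdet n m = mdet n m'"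
  by (rule arg_cong[of _ _ Determinant.det]) (auto intro!: cong_mat)

lemma mdet_leibniz:
  "mdet n m = (\<Sum>p | p permutes {0..<n}. signof p * (\<Prod>i=0..<n. m i (p i)))"
  by (auto simp: det_def'[of _ n] permutes_in_image intro!: sum.cong prod.cong)

lemma mdet_shift_char_poly:
  assumes "M \<in> carrier_mat n n"
  shows "mdet n (\<lambda>i j. M $$ (i, j) - (if i = j then l else 0)) = (-1) ^ n * poly (char_poly M) l"
proof -
  have "Matrix.mat n n (\<lambda>(i, j). M $$ (i, j) - (if i = j then l else 0)) = (-1) \<cdot>\<^sub>m (- (char_matrix M l))"
    using assms by (intro eq_matI) (auto simp: char_matrix_def)
  moreover have "Determinant.det ((-1) \<cdot>\<^sub>m (- (char_matrix M l))) =
      (-1) ^ n * Determinant.det (- (char_matrix M l))"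
    using assms by (simp add: char_matrix_def)
  ultimately show ?thesis
    unfolding char_poly_matrix[OF assms] by simp
qed

lemma mdet_block_upper_zero:
  assumes "\<And>i j. i < m \<Longrightarrow> j < k \<Longrightarrow> f i (m + j) = 0"
  shows "mdet (m + k) f = mdet m f * mdet k (\<lambda>i j. f (m + i) (m + j))"
proof -
  have "Matrix.mat (m + k) (m + k) (\<lambda>(i, j). f i j) =
      four_block_mat (Matrix.mat m m (\<lambda>(i, j). f i j)) (0\<^sub>m m k)
        (Matrix.mat k m (\<lambda>(i, j). f (m + i) j)) (Matrix.mat k k (\<lambda>(i, j). f (m + i) (m + j)))"
  proof -
    have "f i j = 0" if "i < m" "\<not> j < m" "j < m + k" for i j
      using assms[of i "j - m"] that by (simp add: less_diff_conv2)
    then show ?thesis by (intro eq_matI) auto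
  qed
  then show ?thesis
    by (simp add: det_four_block_mat_upper_right_zero[of _ m _ k])
qed

lemma mdet_block_lower_zero:
  assumes "\<And>i j. i < k \<Longrightarrow> j < m \<Longrightarrow> f (m + i) j = 0"
  shows "mdet (m + k) f = mdet m f * mdet k (\<lambda>i j. f (m + i) (m + j))"
proof -
  have "Matrix.mat (m + k) (m + k) (\<lambda>(i, j). f i j) =
      four_block_mat (Matrix.mat m m (\<lambda>(i, j). f i j)) (Matrix.mat m k (\<lambda>(i, j). f i (m + j)))
        (0\<^sub>m k m) (Matrix.mat k k (\<lambda>(i, j). f (m + i) (m + j)))"
  proof -
    have "f i j = 0" if "\<not> i < m" "i < m + k" "j < m" for i j
      using assms[of "i - m" j] that by (simp add: less_diff_conv2)
    then show ?thesis by (intro eq_matI) auto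
  qed
  then show ?thesis
    by (simp add: det_four_block_mat_lower_left_zero[of _ m _ k])
qed

lemma mdet_scale_rows:
  assumes "m \<le> n"
  shows "mdet n (\<lambda>i j. if i < m then c * f i j else f i j) = c ^ m * mdet n f"
proof -
  have "(\<Prod>i=0..<n. if i < m then c * f i (p i) else f i (p i)) = c ^ m * (\<Prod>i=0..<n. f i (p i))"
    for p :: "nat \<Rightarrow> nat"
  proof -
    have "(\<Prod>i=0..<n. if i < m then c * f i (p i) else f i (p i)) =
        (\<Prod>i=0..<n. (if i < m then c else 1) * f i (p i))"
      by (rule prod.cong) auto
    also have "\<dots> = (\<Prod>i=0..<n. if i < m then c else 1) * (\<Prod>i=0..<n. f i (p i))"
      by (rule prod.distrib)
    also have "(\<Prod>i=0..<n. if i < m then c else 1) = (\<Prod>i=0..<m. c)"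
      by (rule prod.mono_neutral_cong_right) (use assms in auto)
    finally show ?thesis by simp
  qed
  then show ?thesis
    unfolding mdet_leibniz sum_distrib_left by (simp add: mult.left_commute)
qed

text \<open>In every term of the Leibniz expansion at most \<open>m\<close> factors depend on \<open>s\<close>. For the pencil this
  bounds the degree in \<open>\<gamma>\<close> by the rank of \<open>B\<close>.\<close>
lemma mdet_linear_rows_poly:
  assumes "m \<le> n" "\<And>i j. m \<le> i \<Longrightarrow> i < n \<Longrightarrow> j < n \<Longrightarrow> b i j = 0"
  obtains q where "degree q \<le> m" "\<And>s. poly q s = mdet n (\<lambda>i j. a i j + s * b i j)"
proof -
  define q :: "complex poly" where
    "q = (\<Sum>p | p permutes {0..<n}. Polynomial.smult (signof p) (\<Prod>i=0..<n. [:a i (p i), b i (p i):]))"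
  have deg: "degree (Polynomial.smult (signof p) (\<Prod>i=0..<n. [:a i (p i), b i (p i):])) \<le> m"
    if p: "p permutes {0..<n}" for p
  proof -
    have "degree (\<Prod>i=0..<n. [:a i (p i), b i (p i):]) \<le> (\<Sum>i=0..<n. degree [:a i (p i), b i (p i):])"
      by (rule order.trans[OF degree_prod_sum_le]) (auto simp: o_def)
    also have "\<dots> \<le> (\<Sum>i=0..<n. if i < m then 1 else 0)"
      using assms(2) permutes_in_image[OF p] by (intro sum_mono) auto
    also have "\<dots> = (\<Sum>i=0..<m. 1)"
      by (rule sum.mono_neutral_cong_right) (use assms(1) in auto)
    finally show ?thesis by (auto intro: order.trans[OF degree_smult_le])
  qed
  show ?thesis
  proof (rule that[of q])
    show "degree q \<le> m"
      unfolding q_def by (rule degree_sum_le) (use deg finite_permutations in auto)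
    show "poly q s = mdet n (\<lambda>i j. a i j + s * b i j)" for s
      unfolding q_def mdet_leibniz by (simp add: poly_sum poly_prod)
  qed
qed

section \<open>Simple roots\<close>

lemma order_one_pderiv_nonzero:
  fixes p :: "complex poly"
  assumes "p \<noteq> 0" "order a p = 1"
  shows "poly (pderiv p) a \<noteq> 0"
proof -
  have root: "poly p a = 0" using assms by (simp add: order_root)
  then have "degree p \<noteq> 0" using assms(1) by (metis degree_eq_zeroE poly_pCons poly_0 mult_zero_right add.right_neutral pCons_0_0)
  then have nz: "pderiv p \<noteq> 0" by (simp add: pderiv_eq_0_iff)
  then have "order a p = Suc (order a (pderiv p))"
    using order_pderiv[OF assms(1) root] by simp
  then show ?thesis using assms nz by (simp add: order_root)
qed

lemma all_roots_simple_imp_rsquarefree: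
  fixes p :: "complex poly"
  assumes "p \<noteq> 0" "\<And>a. poly p a = 0 \<Longrightarrow> order a p = 1"
  shows "rsquarefree p"
  unfolding rsquarefree_def using assms by (metis order_0I)

lemma max_roots_imp_simple:
  fixes p :: "complex poly"
  assumes "p \<noteq> 0" "degree p \<le> card {x. poly p x = 0}" "poly p a = 0"
  shows "poly (pderiv p) a \<noteq> 0"
proof -
  have "card {x. poly p x = 0} = degree p"
    using assms(2) card_poly_roots_bound[OF assms(1)] by simp
  then have "rsquarefree p" using rsquarefree_card_degree[OF assms(1)] by simp
  then show ?thesis using assms(3) unfolding rsquarefree_roots by blast
qed

lemma discriminant_nonzero_imp_rsquarefree:
  assumes "discriminant q \<noteq> 0" "q \<noteq> 0"
  shows "rsquarefree q"
  unfolding rsquarefree_roots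
proof (intro allI notI)
  fix a assume a: "poly q a = 0 \<and> poly (pderiv q) a = 0"
  then have "[:- a, 1:] dvd gcd q (pderiv q)" by (simp add: poly_eq_0_iff_dvd)
  moreover have "gcd q (pderiv q) \<noteq> 0" using assms(2) by simp
  ultimately have "degree [:- a, 1:] \<le> degree (gcd q (pderiv q))" by (rule dvd_imp_degree_le)
  then have "resultant q (pderiv q) = 0" by (subst resultant_0_gcd) simp
  then show False using assms(1) by (simp add: discriminant_def)
qed

text \<open>Caratheodory's form of the derivative, which allows \<open>h\<close> to be merely continuous.\<close>
lemma derivative_of_linear_factor:
  fixes f h :: "complex \<Rightarrow> complex"
  assumes "\<And>z. f z = (z - a) * h z" "isCont h a"
  shows "(f has_field_derivative h a) (at a)"
  unfolding CARAT_DERIV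
  by (rule exI[of _ h]) (use assms in \<open>auto simp: mult.commute\<close>)

section \<open>The determinant of the pencil\<close>

locale cyclic_pencil =
  fixes A B :: "'h::complex_inner_space \<Rightarrow> 'h" and \<sigma>\<^sub>1 \<sigma>\<^sub>2 :: real and N :: nat
  assumes fd: "\<exists>S :: 'h set. finite S \<and> cvec.span S = UNIV"
    and dim_H: "cvec.dim (UNIV :: 'h set) = N"
    and A: "self_adjoint A" and B: "sectorial B \<sigma>\<^sub>1 \<sigma>\<^sub>2" and cyclic: "cyclic_for B A"
begin

lemma clinear_A: "clinear A" using A unfolding self_adjoint_def by simp

lemma clinear_B: "clinear B" using B unfolding sectorial_def by simp

lemma clinear_perturbed: "clinear (perturbed A B \<gamma>)"
  unfolding perturbed_def
  by (rule clinearI)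
    (simp_all add: clinear_add[OF clinear_A] clinear_add[OF clinear_B] clinear_scale[OF clinear_A]
      clinear_scale[OF clinear_B] scaleC_add_right scaleC_scaleC algebra_simps)

lemma perturbed_0: "perturbed A B 0 = A"
  by (simp add: perturbed_def)

lemma standard_basis: "is_basis UNIV (basis_list (UNIV :: 'h set))"
  by (rule basis_list_is_basis[OF fd]) simp

text \<open>The pencil determinant is this monic polynomial up to the sign \<open>(-1)\<^sup>N\<close>, see
  \<open>pencil_det_eq_poly\<close>.\<close>
definition pencil_poly :: "complex \<Rightarrow> complex poly" where
  "pencil_poly \<gamma> = char_poly (op_matrix UNIV (perturbed A B \<gamma>))"

lemma pencil_poly_basis:
  assumes "is_basis UNIV bs"
  shows "pencil_poly \<gamma> = char_poly (mat_rep bs bs (perturbed A B \<gamma>))"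
  unfolding pencil_poly_def op_matrix_eq
  by (rule char_poly_similar, rule mat_rep_similar[OF standard_basis assms clinear_perturbed])

lemma pencil_poly_monic: "degree (pencil_poly \<gamma>) = N" "pencil_poly \<gamma> \<noteq> 0"
proof -
  have "op_matrix UNIV (perturbed A B \<gamma>) \<in> carrier_mat N N"
    using length_basis[OF standard_basis] dim_H by (simp add: op_matrix_eq mat_rep_def)
  from degree_monic_char_poly[OF this]
  show "degree (pencil_poly \<gamma>) = N" "pencil_poly \<gamma> \<noteq> 0"
    unfolding pencil_poly_def by auto
qed

lemma pencil_det_basis:
  assumes bs: "is_basis UNIV bs"
  shows "pencil_det A B \<gamma> l = mdet (length bs) (\<lambda>i j. coord bs (A (bs ! j)) i +
      \<gamma> * coord bs (B (bs ! j)) i - (if i = j then l else 0))"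
proof -
  let ?T = "\<lambda>v. perturbed A B \<gamma> v - l *\<^sub>C v"
  have lin: "clinear ?T"
    by (rule clinearI) (simp_all add: clinear_add[OF clinear_perturbed]
        clinear_scale[OF clinear_perturbed] scaleC_add_right scaleC_scaleC
        cvec.scale_right_diff_distrib algebra_simps)
  have "pencil_det A B \<gamma> l = Determinant.det (mat_rep bs bs ?T)"
    unfolding pencil_det_def op_det_def op_matrix_eq
    by (rule det_similar, rule mat_rep_similar[OF standard_basis bs lin])
  also have "mat_rep bs bs ?T = Matrix.mat (length bs) (length bs) (\<lambda>(i, j). coord bs (A (bs ! j)) i +
      \<gamma> * coord bs (B (bs ! j)) i - (if i = j then l else 0))"
    unfolding mat_rep_def
    by (intro cong_mat)
      (auto simp: coord_diff[OF bs] coord_scale[OF bs] coord_add[OF bs] perturbed_def coord_nth[OF bs])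
  finally show ?thesis .
qed

lemma pencil_det_eq_poly: "pencil_det A B \<gamma> l = (-1) ^ N * poly (pencil_poly \<gamma>) l"
proof -
  let ?bs = "basis_list (UNIV :: 'h set)"
  let ?M = "mat_rep ?bs ?bs (perturbed A B \<gamma>)"
  have len: "length ?bs = N" using length_basis[OF standard_basis] dim_H by simp
  have "pencil_det A B \<gamma> l = mdet N (\<lambda>i j. ?M $$ (i, j) - (if i = j then l else 0))"
    unfolding pencil_det_basis[OF standard_basis] len
    by (intro mdet_cong) (auto simp: mat_rep_def perturbed_def coord_add[OF standard_basis]
        coord_scale[OF standard_basis] len)
  also have "\<dots> = (-1) ^ N * poly (pencil_poly \<gamma>) l"
    unfolding pencil_poly_def op_matrix_eq
    by (rule mdet_shift_char_poly) (simp add: mat_rep_def len)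
  finally show ?thesis .
qed

lemma pencil_zero_iff: "pencil_det A B \<gamma> l = 0 \<longleftrightarrow> poly (pencil_poly \<gamma>) l = 0"
  by (simp add: pencil_det_eq_poly)

lemma Spec_eq_zeros: "Spec (perturbed A B \<gamma>) = {l. pencil_det A B \<gamma> l = 0}"
  unfolding pencil_zero_iff pencil_poly_basis[OF standard_basis]
  using spec_on_iff_char_poly[OF standard_basis clinear_perturbed] by auto

lemma finite_zeros: "finite {l. pencil_det A B \<gamma> l = 0}"
  unfolding pencil_zero_iff by (rule poly_roots_finite[OF pencil_poly_monic(2)])

lemma card_zeros_le: "card {l. pencil_det A B \<gamma> l = 0} \<le> N"
  unfolding pencil_zero_iff
  using card_poly_roots_bound[OF pencil_poly_monic(2)] pencil_poly_monic(1) by simp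

lemma card_zeros_iff: "card {l. pencil_det A B \<gamma> l = 0} = N \<longleftrightarrow> rsquarefree (pencil_poly \<gamma>)"
  unfolding pencil_zero_iff
  using rsquarefree_card_degree[OF pencil_poly_monic(2)] pencil_poly_monic(1) by simp

lemma zeros_simple_not_exceptional1:
  assumes "\<gamma> \<in> sector \<sigma>\<^sub>1 \<sigma>\<^sub>2" "\<gamma> \<notin> exceptional1 A B \<sigma>\<^sub>1 \<sigma>\<^sub>2"
  shows "card {l. pencil_det A B \<gamma> l = 0} = N"
proof -
  define q where "q = Polynomial.smult ((-1) ^ N) (pencil_poly \<gamma>)"
  have q: "poly q l = pencil_det A B \<gamma> l" for l
    by (simp add: q_def pencil_det_eq_poly)
  then have "discriminant q \<noteq> 0"
    using assms unfolding exceptional1_def by blast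
  moreover have "q \<noteq> 0" using pencil_poly_monic(2) by (simp add: q_def)
  ultimately have "rsquarefree q" by (rule discriminant_nonzero_imp_rsquarefree)
  then have "rsquarefree (pencil_poly \<gamma>)"
    unfolding rsquarefree_roots q_def by (simp add: pderiv_smult)
  then show ?thesis by (simp add: card_zeros_iff)
qed

lemma zeros_simple_at_0:
  assumes "\<forall>l \<in> Spec A. alg_mult A l = 1"
  shows "card {l. pencil_det A B 0 l = 0} = N"
  unfolding card_zeros_iff
proof (rule all_roots_simple_imp_rsquarefree[OF pencil_poly_monic(2)])
  fix a assume "poly (pencil_poly 0) a = 0"
  then have "a \<in> Spec A"
    using Spec_eq_zeros[of 0] by (simp add: pencil_zero_iff perturbed_0)
  then show "order a (pencil_poly 0) = 1"
    using assms by (simp add: alg_mult_on_def pencil_poly_def perturbed_0)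
qed

lemma pencil_jointly_C1: "jointly_C1 (pencil_det A B)"
proof -
  let ?bs = "basis_list (UNIV :: 'h set)"
  have "jointly_C1 (\<lambda>\<gamma> l. mdet (length ?bs) (\<lambda>i j. coord ?bs (A (?bs ! j)) i +
      \<gamma> * coord ?bs (B (?bs ! j)) i - (if i = j then l else 0)))"
  proof (rule jointly_C1_det)
    fix i j
    show "jointly_C1 (\<lambda>\<gamma> l. coord ?bs (A (?bs ! j)) i +
      \<gamma> * coord ?bs (B (?bs ! j)) i - (if i = j then l else 0))"
      by (intro jointly_C1_intros)
  qed
  then show ?thesis
    unfolding pencil_det_basis[OF standard_basis, symmetric] .
qed

lemma pencil_snd_partial:
  assumes "has_partials (pencil_det A B) p1 p2"
  shows "p2 \<gamma> l = (-1) ^ N * poly (pderiv (pencil_poly \<gamma>)) l"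
proof -
  have "((\<lambda>l. pencil_det A B \<gamma> l) has_field_derivative
      (-1) ^ N * poly (pderiv (pencil_poly \<gamma>)) l) (at l)"
    unfolding pencil_det_eq_poly by (intro DERIV_cmult poly_DERIV)
  then show ?thesis
    using has_partials_snd_deriv[OF assms] DERIV_unique by blast
qed

lemma pencil_snd_partial_nonzero:
  assumes "has_partials (pencil_det A B) p1 p2"
    and "card {l. pencil_det A B \<gamma> l = 0} = N" "pencil_det A B \<gamma> l = 0"
  shows "p2 \<gamma> l \<noteq> 0"
  using assms(2,3) unfolding pencil_snd_partial[OF assms(1)] card_zeros_iff rsquarefree_roots
  by (simp add: pencil_zero_iff)

lemma range_Ker_orthogonal: "u \<in> range B \<Longrightarrow> v \<in> Ker B \<Longrightarrow> cinner u v = 0"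
  using sectorial_form_zero(2)[OF B] by (auto simp: Ker_def)

lemma subspace_range: "cvec.subspace (range B)"
proof (rule cvec.subspaceI)
  show "0 \<in> range B" using clinear_zero[OF clinear_B] by (metis rangeI)
  fix x y c assume x: "x \<in> range B"
  then obtain p where p: "x = B p" by auto
  show "c *\<^sub>C x \<in> range B"
    unfolding p clinear_scale[OF clinear_B, symmetric] by simp
  assume "y \<in> range B"
  then obtain q where q: "y = B q" by auto
  show "x + y \<in> range B"
    unfolding p q clinear_add[OF clinear_B, symmetric] by simp
qed

lemma subspace_Ker: "cvec.subspace (Ker B)"
  by (rule cvec.subspaceI)
    (auto simp: Ker_def clinear_zero[OF clinear_B] clinear_add[OF clinear_B]
      clinear_scale[OF clinear_B])

text \<open>The component of \<open>x\<close> orthogonal to the range has vanishing form, and therefore lies in the kernel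
  by sectoriality. Together with \<open>range_Ker_orthogonal\<close> this is the orthogonal decomposition which
  reduces \<open>B\<close>.\<close>
lemma range_plus_Ker: "\<exists>u\<in>range B. \<exists>v\<in>Ker B. x = u + v"
proof -
  obtain u where u: "u \<in> range B" "\<And>z. z \<in> range B \<Longrightarrow> cinner (x - u) z = 0"
    using orth_decomposition[OF fd subspace_range] by metis
  have "cinner (B (x - u)) (x - u) = 0"
    using u(2) orth_commute by blast
  then have "x - u \<in> Ker B"
    using sectorial_form_zero(1)[OF B] by (simp add: Ker_def)
  then show ?thesis using u(1) by (metis add.commute diff_add_cancel)
qed

text \<open>A basis of the range followed by a basis of the kernel. With respect to it, \<open>B\<close> has a single
  non-zero diagonal block, in the upper left corner, and the lower right block of \<open>A\<close> is the matrix of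
  the truncation.\<close>
abbreviation "us \<equiv> basis_list (range B)"
abbreviation "vs \<equiv> basis_list (Ker B)"

lemma is_basis_us: "is_basis (range B) us" by (rule basis_list_is_basis[OF fd subspace_range])

lemma is_basis_vs: "is_basis (Ker B) vs" by (rule basis_list_is_basis[OF fd subspace_Ker])

lemma is_basis_us_vs: "is_basis UNIV (us @ vs)"
  by (rule basis_append[OF is_basis_us is_basis_vs range_Ker_orthogonal range_plus_Ker])

lemma length_us: "length us = crank B"
  unfolding crank_def by (rule length_basis[OF is_basis_us])

lemma length_us_vs: "length us + length vs = N"
  using length_basis[OF is_basis_us_vs] dim_H by simp

definition A_entry where "A_entry i j = coord (us @ vs) (A ((us @ vs) ! j)) i"
definition B_entry where "B_entry i j = coord (us @ vs) (B ((us @ vs) ! j)) i"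

lemma pencil_det_adapted:
  "pencil_det A B \<gamma> l = mdet (length us + length vs) (\<lambda>i j. A_entry i j + \<gamma> * B_entry i j - (if i = j then l else 0))"
  unfolding pencil_det_basis[OF is_basis_us_vs] A_entry_def B_entry_def by simp

lemma zero_in_Ker: "0 \<in> Ker B" by (simp add: Ker_def clinear_zero[OF clinear_B])

lemma B_entry_low_row: "i < length vs \<Longrightarrow> B_entry (length us + i) j = 0"
  using coord_append(2)[OF is_basis_us is_basis_vs is_basis_us_vs rangeI zero_in_Ker, of i "(us @ vs) ! j"]
  by (simp add: B_entry_def)

lemma B_entry_right_col: "j < length vs \<Longrightarrow> B_entry i (length us + j) = 0"
proof -
  assume "j < length vs"
  then have "B ((us @ vs) ! (length us + j)) = 0"
    using is_basis_nth[OF is_basis_vs] by (simp add: Ker_def)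
  then show ?thesis by (simp add: B_entry_def)
qed

lemma B_entry_block: "i < length us \<Longrightarrow> j < length us \<Longrightarrow> B_entry i j = mat_rep us us B $$ (i, j)"
  using coord_append(1)[OF is_basis_us is_basis_vs is_basis_us_vs rangeI zero_in_Ker, of i "us ! j"]
  by (simp add: B_entry_def mat_rep_def nth_append)

lemma clinear_truncation: "clinear (truncation (Ker B) A)"
  by (rule clinearI)
    (simp_all add: truncation_def clinear_add[OF orth_proj_props(3)[OF fd subspace_Ker]]
      clinear_scale[OF orth_proj_props(3)[OF fd subspace_Ker]] clinear_add[OF clinear_A]
      clinear_scale[OF clinear_A])

lemma A_entry_block:
  assumes "i < length vs" "j < length vs"
  shows "A_entry (length us + i) (length us + j) = mat_rep vs vs (truncation (Ker B) A) $$ (i, j)"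
proof -
  have v: "vs ! j \<in> Ker B" by (rule is_basis_nth[OF is_basis_vs assms(2)])
  obtain u w where uw: "u \<in> range B" "w \<in> Ker B" "A (vs ! j) = u + w"
    using range_plus_Ker by blast
  have "orth_proj (Ker B) (A (vs ! j)) = w"
    by (rule orth_proj_unique[OF subspace_Ker uw(2)])
      (simp add: uw(3) range_Ker_orthogonal[OF uw(1)])
  then have "truncation (Ker B) A (vs ! j) = w"
    using orth_proj_props(4)[OF fd subspace_Ker v] by (simp add: truncation_def)
  then show ?thesis
    using coord_append(2)[OF is_basis_us is_basis_vs is_basis_us_vs uw(1,2), of i] assms uw(3)
    by (simp add: A_entry_def mat_rep_def)
qed

lemma pencil_fst_poly:
  obtains q where "degree q \<le> crank B" "\<And>s. poly q s = pencil_det A B s l"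
proof -
  have rows: "B_entry i j = 0" if "length us \<le> i" "i < length us + length vs" for i j
    using B_entry_low_row[of "i - length us" j] that by auto
  obtain q where q: "degree q \<le> length us"
    "\<And>s. poly q s = mdet (length us + length vs)
       (\<lambda>i j. (A_entry i j - (if i = j then l else 0)) + s * B_entry i j)"
    by (rule mdet_linear_rows_poly[of "length us" "length us + length vs" B_entry
          "\<lambda>i j. A_entry i j - (if i = j then l else 0)"]) (use rows in auto)
  show ?thesis
  proof (rule that[of q])
    show "poly q s = pencil_det A B s l" for s
      unfolding q(2) pencil_det_adapted by (simp add: algebra_simps)
  qed (use q(1) length_us in simp)
qed

text \<open>Off the exceptional set, a polynomial in \<open>s\<close> of degree at most the rank of \<open>B\<close> attains this
  number of distinct roots, hence all of them are simple. It is not the zero polynomial because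
  \<open>l\<close>, being non-real, is not an eigenvalue of \<open>A\<close>.\<close>
lemma pencil_fst_partial_nonzero:
  assumes p: "has_partials (pencil_det A B) p1 p2"
    and g: "\<gamma> \<in> sector \<sigma>\<^sub>1 \<sigma>\<^sub>2" "\<gamma> \<notin> exceptional2 A B \<sigma>\<^sub>1 \<sigma>\<^sub>2" and "\<gamma> \<noteq> 0"
    and l: "pencil_det A B \<gamma> l = 0"
  shows "p1 \<gamma> l \<noteq> 0"
proof -
  have "Im l > 0"
    using perturbed_spec_upper_half_plane[OF A B cyclic g(1) \<open>\<gamma> \<noteq> 0\<close>] l Spec_eq_zeros by blast
  then have card: "card {s. pencil_det A B s l = 0} = crank B"
    using g l unfolding exceptional2_def by blast
  obtain q where q: "degree q \<le> crank B" "\<And>s. poly q s = pencil_det A B s l"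
    using pencil_fst_poly by metis
  have "l \<notin> Spec A"
    using symmetric_spec_real[of UNIV A l] A \<open>Im l > 0\<close> unfolding self_adjoint_def by auto
  then have "poly q 0 \<noteq> 0"
    using Spec_eq_zeros[of 0] unfolding q(2) perturbed_0 by simp
  then have "q \<noteq> 0" by auto
  then have "poly (pderiv q) \<gamma> \<noteq> 0"
    by (rule max_roots_imp_simple) (use q l card in auto)
  moreover have "((\<lambda>s. pencil_det A B s l) has_field_derivative poly (pderiv q) \<gamma>) (at \<gamma>)"
    unfolding q(2)[symmetric] by (rule poly_DERIV)
  then have "p1 \<gamma> l = poly (pderiv q) \<gamma>"
    using has_partials_fst_deriv[OF p] DERIV_unique by blast
  ultimately show ?thesis by simp
qed

text \<open>Take an eigenvector \<open>e\<close> of \<open>A\<close> for \<open>l\<close>, followed by a basis of its orthogonal complement, which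
  reduces \<open>A\<close>. The first row of \<open>A + \<gamma> B - l\<close> is then \<open>\<gamma>\<close> times the first row of \<open>B\<close>.
  Pulling out \<open>\<gamma>\<close> leaves a determinant \<open>H\<close> that at \<open>\<gamma> = 0\<close> is the product of
  \<open>\<langle>Be, e\<rangle> / \<langle>e, e\<rangle>\<close> and the determinant \<open>D\<close> of \<open>A - l\<close> on the complement.
  The same block structure gives \<open>p(0, z) = (l - z) D(z)\<close>, so that \<open>D(l) \<noteq> 0\<close> expresses the
  simplicity of the zero \<open>l\<close> of \<open>p(0, \<cdot>)\<close>.\<close>
lemma pencil_fst_partial_nonzero_at_0:
  assumes p: "has_partials (pencil_det A B) p1 p2" and l: "pencil_det A B 0 l = 0"
    and p2: "p2 0 l \<noteq> 0"
  shows "p1 0 l \<noteq> 0"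
proof -
  have "l \<in> Spec A" using l Spec_eq_zeros[of 0] by (simp add: perturbed_0)
  then obtain e where e: "e \<noteq> 0" "A e = l *\<^sub>C e" unfolding spec_on_def by auto
  have ee: "cinner e e \<noteq> 0" using e(1) cinner_self_eq_0 by blast
  have Be: "cinner (B e) e \<noteq> 0"
    by (rule eigenvector_form_nonzero[OF A B cyclic, of 0 e l]) (use e perturbed_0 in auto)
  define V where "V = {x. cinner x e = 0}"
  define ws where "ws = basis_list V"
  define k where "k = length ws"
  have subV: "cvec.subspace V"
    using orth_complement_subspace[of "{e}"] by (simp add: V_def)
  have ws: "is_basis V ws" unfolding ws_def by (rule basis_list_is_basis[OF fd subV])
  have eb: "is_basis (cvec.span {e}) [e]"
    using e(1) by (simp add: is_basis_def cvec.dependent_single)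
  have e_span: "c *\<^sub>C e \<in> cvec.span {e}" for c
    by (intro cvec.span_scale cvec.span_base) simp
  have split: "x - (cinner x e / cinner e e) *\<^sub>C e \<in> V" for x
    using ee by (simp add: V_def cinner_diff_left cinner_scaleC_left)
  have bs: "is_basis UNIV ([e] @ ws)"
  proof (rule basis_append[OF eb ws])
    fix u v assume "u \<in> cvec.span {e}" "v \<in> V"
    then show "cinner u v = 0"
      using orth_span[of "{e}" v u] orth_commute[of u v] by (simp add: V_def)
  next
    fix x
    show "\<exists>u\<in>cvec.span {e}. \<exists>v\<in>V. x = u + v"
      using split[of x] e_span by (metis add.commute diff_add_cancel)
  qed
  let ?bs = "[e] @ ws"
  define a' where "a' = (\<lambda>i j. coord ?bs (A (?bs ! j)) i)"
  define b' where "b' = (\<lambda>i j. coord ?bs (B (?bs ! j)) i)"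
  have zV: "0 \<in> V" by (simp add: V_def)
  have zE: "0 \<in> cvec.span {e}" by (rule cvec.span_zero)
  have AV: "A x \<in> V" if "x \<in> V" for x
    using that A e(2) unfolding V_def self_adjoint_def by (simp add: cinner_scaleC_right)
  have ce: "coord [e] (c *\<^sub>C e) 0 = c" for c
    using coord_combination[OF eb, of 0 "\<lambda>_. c"] by simp
  have a00: "a' 0 0 = l"
    using coord_append(1)[OF eb ws bs e_span[of l] zV, of 0] e(2) ce by (simp add: a'_def)
  have ai0: "a' (1 + i) 0 = 0" if "i < k" for i
    using coord_append(2)[OF eb ws bs e_span[of l] zV, of i] e(2) that by (simp add: a'_def k_def)
  have a0j: "a' 0 (1 + j) = 0" if "j < k" for j
    using coord_append(1)[OF eb ws bs zE AV[OF is_basis_nth[OF ws]], of j 0] that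
    by (simp add: a'_def k_def)
  have b00: "b' 0 0 = cinner (B e) e / cinner e e"
    using coord_append(1)[OF eb ws bs e_span[of "cinner (B e) e / cinner e e"] split[of "B e"], of 0]
      ce by (simp add: b'_def)
  have pencil: "pencil_det A B \<gamma> z = mdet (1 + k) (\<lambda>i j. a' i j + \<gamma> * b' i j - (if i = j then z else 0))"
    for \<gamma> z
    unfolding pencil_det_basis[OF bs] a'_def b'_def k_def by simp
  define D where "D = (\<lambda>z. mdet k (\<lambda>i j. a' (1 + i) (1 + j) - (if 1 + i = 1 + j then z else 0)))"
  define H where "H = (\<lambda>\<gamma>. mdet (1 + k) (\<lambda>i j. if i < 1 then b' i j
      else a' i j + \<gamma> * b' i j - (if i = j then l else 0)))"
  have "pencil_det A B \<gamma> l = (\<gamma> - 0) * H \<gamma>" for \<gamma>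
  proof -
    have "pencil_det A B \<gamma> l = mdet (1 + k) (\<lambda>i j. if i < 1 then \<gamma> *
        (if i < 1 then b' i j else a' i j + \<gamma> * b' i j - (if i = j then l else 0))
        else (if i < 1 then b' i j else a' i j + \<gamma> * b' i j - (if i = j then l else 0)))"
      unfolding pencil
    proof (rule mdet_cong)
      fix i j assume "i < 1 + k" "j < 1 + k"
      then show "a' i j + \<gamma> * b' i j - (if i = j then l else 0) = (if i < 1 then \<gamma> *
        (if i < 1 then b' i j else a' i j + \<gamma> * b' i j - (if i = j then l else 0))
        else (if i < 1 then b' i j else a' i j + \<gamma> * b' i j - (if i = j then l else 0)))"
        using a00 a0j[of "j - 1"] by (cases "j = 0") auto
    qed
    also have "\<dots> = \<gamma> ^ 1 * H \<gamma>" unfolding H_def by (rule mdet_scale_rows) simp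
    finally show ?thesis by simp
  qed
  moreover have "isCont H 0"
  proof -
    have "jointly_C1 (\<lambda>\<gamma> (y::complex). H \<gamma>)"
      unfolding H_def
    proof (rule jointly_C1_det)
      fix i j
      show "jointly_C1 (\<lambda>\<gamma> y. if i < 1 then b' i j else a' i j + \<gamma> * b' i j - (if i = j then l else 0))"
        by (intro jointly_C1_intros)
    qed
    then show ?thesis
      unfolding jointly_C1_def using has_partials_fst_deriv DERIV_isCont by fastforce
  qed
  ultimately have "((\<lambda>\<gamma>. pencil_det A B \<gamma> l) has_field_derivative H 0) (at 0)"
    by (rule derivative_of_linear_factor)
  then have p1: "p1 0 l = H 0"
    using has_partials_fst_deriv[OF p] DERIV_unique by blast
  have pencil0: "pencil_det A B 0 z = (z - l) * - D z" for z
  proof -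
    have "pencil_det A B 0 z = mdet (1 + k) (\<lambda>i j. a' i j - (if i = j then z else 0))"
      unfolding pencil by simp
    also have "\<dots> = mdet 1 (\<lambda>i j. a' i j - (if i = j then z else 0)) * D z"
      unfolding D_def by (rule mdet_block_upper_zero) (use a0j in auto)
    also have "mdet 1 (\<lambda>i j. a' i j - (if i = j then z else 0)) = l - z"
      using a00 by (simp add: det_single)
    finally show ?thesis by (simp add: algebra_simps)
  qed
  moreover have "isCont (\<lambda>z. - D z) l"
  proof -
    have "jointly_C1 (\<lambda>(x::complex) z. D z)"
      unfolding D_def
    proof (rule jointly_C1_det)
      fix i j
      show "jointly_C1 (\<lambda>x z. a' (1 + i) (1 + j) - (if 1 + i = 1 + j then z else 0))"
        by (intro jointly_C1_intros)
    qed
    then obtain d1 d2 where "has_partials (\<lambda>x. D) d1 d2"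
      unfolding jointly_C1_def by blast
    then have "isCont D l"
      using has_partials_snd_deriv DERIV_isCont by blast
    then show ?thesis by (rule continuous_minus)
  qed
  ultimately have "((\<lambda>z. pencil_det A B 0 z) has_field_derivative - D l) (at l)"
    by (rule derivative_of_linear_factor)
  then have "p2 0 l = - D l"
    using has_partials_snd_deriv[OF p] DERIV_unique by blast
  then have "D l \<noteq> 0" using p2 by simp
  moreover have "H 0 = b' 0 0 * D l"
  proof -
    have "H 0 = mdet 1 (\<lambda>i j. if i < 1 then b' i j else a' i j + 0 * b' i j - (if i = j then l else 0)) *
        mdet k (\<lambda>i j. if 1 + i < 1 then b' (1 + i) (1 + j) else a' (1 + i) (1 + j) +
          0 * b' (1 + i) (1 + j) - (if 1 + i = 1 + j then l else 0))"
      unfolding H_def by (rule mdet_block_lower_zero) (use ai0 in auto)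
    then show ?thesis by (simp add: D_def det_single)
  qed
  ultimately show ?thesis using p1 b00 Be ee by simp
qed

end

section \<open>The pencil at infinity\<close>

lemma eigenvalues_increasing_bij:
  assumes fin: "finite (spec_on K T)" and real: "\<And>l. l \<in> spec_on K T \<Longrightarrow> Im l = 0"
  shows "bij_betw (\<lambda>r. complex_of_real (eigenvalues_increasing K T ! r))
    {..<card (spec_on K T)} (spec_on K T)"
proof -
  define R where "R = {x. complex_of_real x \<in> spec_on K T}"
  have img: "complex_of_real ` R = spec_on K T"
  proof (intro equalityI subsetI)
    fix l assume "l \<in> spec_on K T"
    moreover from real[OF this] have "l = complex_of_real (Re l)" by (simp add: complex_eq_iff)
    ultimately show "l \<in> complex_of_real ` R" unfolding R_def by (metis image_eqI mem_Collect_eq)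
  qed (auto simp: R_def)
  have inj: "inj_on complex_of_real R" by (auto intro: inj_onI)
  have fR: "finite R" using fin finite_imageD[OF _ inj] img by simp
  have card: "card R = card (spec_on K T)" using card_image[OF inj] img by simp
  have "bij_betw ((!) (sorted_list_of_set R)) {..<card (spec_on K T)} R"
    by (rule bij_betw_nth) (use fR card in auto)
  then have "bij_betw (complex_of_real \<circ> (!) (sorted_list_of_set R)) {..<card (spec_on K T)} (spec_on K T)"
    by (rule bij_betw_trans) (use inj img in \<open>auto simp: bij_betw_def\<close>)
  then show ?thesis by (simp add: o_def eigenvalues_increasing_def R_def)
qed

context cyclic_pencil
begin

text \<open>The characteristic polynomial of the invertible part of \<open>B\<close>; its roots are the non-zero
  eigenvalues of \<open>B\<close>.\<close>
definition range_poly :: "complex poly" where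
  "range_poly = char_poly (mat_rep us us B)"

lemma range_poly_degree: "degree range_poly = length us" "range_poly \<noteq> 0"
proof -
  have "mat_rep us us B \<in> carrier_mat (length us) (length us)" by (simp add: mat_rep_def)
  from degree_monic_char_poly[OF this]
  show "degree range_poly = length us" "range_poly \<noteq> 0" unfolding range_poly_def by auto
qed

lemma mdet_B_entry_shift:
  "mdet (length us) (\<lambda>i j. B_entry i j - (if i = j then l else 0)) = (-1) ^ length us * poly range_poly l"
proof -
  have "mdet (length us) (\<lambda>i j. B_entry i j - (if i = j then l else 0)) =
      mdet (length us) (\<lambda>i j. mat_rep us us B $$ (i, j) - (if i = j then l else 0))"
    by (rule mdet_cong) (simp add: B_entry_block)
  then show ?thesis
    unfolding range_poly_def by (simp add: mdet_shift_char_poly mat_rep_def)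
qed

lemma range_poly_nonzero_at_0: "poly range_poly 0 \<noteq> 0"
proof
  assume "poly range_poly 0 = 0"
  then have "0 \<in> spec_on (range B) B"
    unfolding range_poly_def by (subst spec_on_iff_char_poly[OF is_basis_us clinear_B]) auto
  then obtain v where v: "v \<in> range B" "v \<noteq> 0" "B v = 0"
    unfolding spec_on_def by auto
  then have "cinner v v = 0" by (intro range_Ker_orthogonal) (auto simp: Ker_def)
  then show False using v(2) cinner_self_eq_0 by blast
qed

lemma mdet_B_entry_nonzero: "mdet (length us) B_entry \<noteq> 0"
  using mdet_B_entry_shift[of 0] range_poly_nonzero_at_0 by simp

lemma mdet_diag: "mdet k (\<lambda>i j. - (if i = j then l else 0)) = (- l) ^ k"
proof -
  have "mdet k (\<lambda>i j. - (if i = j then l else 0)) =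
      mdet k (\<lambda>i j. if i < k then - l * (if i = j then 1 else 0) else (if i = j then 1 else 0))"
    by (rule mdet_cong) auto
  also have "\<dots> = (- l) ^ k * mdet k (\<lambda>i j. if i = j then 1 else 0)"
    by (rule mdet_scale_rows) simp
  also have "mdet k (\<lambda>i j. if i = j then 1 else 0) = 1"
    by (simp flip: one_mat_def)
  finally show ?thesis by simp
qed

lemma mdet_full_B_entry_shift:
  "mdet (length us + length vs) (\<lambda>i j. B_entry i j - (if i = j then l else 0)) =
    (-1) ^ N * (poly range_poly l * l ^ length vs)"
proof -
  have "mdet (length us + length vs) (\<lambda>i j. B_entry i j - (if i = j then l else 0)) =
      mdet (length us) (\<lambda>i j. B_entry i j - (if i = j then l else 0)) *
      mdet (length vs) (\<lambda>i j. B_entry (length us + i) (length us + j) - (if length us + i = length us + j then l else 0))"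
    by (rule mdet_block_upper_zero) (auto simp: B_entry_right_col)
  also have "mdet (length vs) (\<lambda>i j. B_entry (length us + i) (length us + j) -
      (if length us + i = length us + j then l else 0)) = (- l) ^ length vs"
    unfolding mdet_diag[symmetric] by (rule mdet_cong) (auto simp: B_entry_right_col)
  finally show ?thesis
    unfolding mdet_B_entry_shift length_us_vs[symmetric] power_minus[of l] by (simp add: power_add)
qed

lemma char_poly_B: "char_poly (op_matrix UNIV B) = range_poly * [:0, 1:] ^ length vs"
proof -
  have len: "length (us @ vs) = N" using length_us_vs by simp
  have cp: "char_poly (op_matrix UNIV B) = char_poly (mat_rep (us @ vs) (us @ vs) B)"
    unfolding op_matrix_eq by (rule char_poly_similar, rule mat_rep_similar[OF standard_basis is_basis_us_vs clinear_B])
  have "poly (char_poly (op_matrix UNIV B)) l = poly (range_poly * [:0, 1:] ^ length vs) l" for l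
  proof -
    have "(-1) ^ N * poly (char_poly (op_matrix UNIV B)) l =
        mdet N (\<lambda>i j. mat_rep (us @ vs) (us @ vs) B $$ (i, j) - (if i = j then l else 0))"
      unfolding cp by (rule mdet_shift_char_poly[symmetric]) (use len in \<open>simp add: mat_rep_def\<close>)
    also have "\<dots> = mdet (length us + length vs) (\<lambda>i j. B_entry i j - (if i = j then l else 0))"
      unfolding length_us_vs using len by (intro mdet_cong) (simp add: mat_rep_def B_entry_def)
    also have "\<dots> = (-1) ^ N * (poly range_poly l * l ^ length vs)" by (rule mdet_full_B_entry_shift)
    finally show ?thesis by (simp add: poly_power)
  qed
  then show ?thesis by (simp add: poly_eq_poly_eq_iff[symmetric] fun_eq_iff)
qed

lemma Spec_B_nonzero: "Spec B - {0} = {l. poly range_poly l = 0}"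
proof -
  have "l \<in> Spec B \<longleftrightarrow> poly (char_poly (op_matrix UNIV B)) l = 0" for l
    unfolding op_matrix_eq by (rule spec_on_iff_char_poly[OF standard_basis clinear_B]) simp
  then have "l \<in> Spec B \<longleftrightarrow> poly range_poly l = 0 \<or> l = 0 \<and> length vs \<noteq> 0" for l
    unfolding char_poly_B by (auto simp: poly_power)
  then show ?thesis using range_poly_nonzero_at_0 by auto
qed

text \<open>The kernel contributes only a power of the indeterminate to the characteristic polynomial of \<open>B\<close>,
  so non-zero eigenvalues keep their multiplicity when \<open>B\<close> is restricted to its range, a space of
  dimension \<open>crank B\<close>.\<close>
lemma simple_nonzero_eigenvalues_B:
  assumes "\<forall>l \<in> Spec B - {0}. alg_mult B l = 1"
  shows "card (Spec B - {0}) = crank B"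
    and "l \<in> Spec B - {0} \<Longrightarrow> poly (pderiv (char_poly (op_matrix UNIV B))) l \<noteq> 0"
proof -
  have nz: "char_poly (op_matrix UNIV B) \<noteq> 0"
    unfolding char_poly_B using range_poly_degree(2) by simp
  have ord: "order l (char_poly (op_matrix UNIV B)) = 1" if "l \<in> Spec B - {0}" for l
    using assms that unfolding alg_mult_on_def by blast
  have "order l range_poly = 1" if "poly range_poly l = 0" for l
  proof -
    have "l \<in> Spec B - {0}" using that Spec_B_nonzero by blast
    then have "order l range_poly + order l ([:0, 1:] ^ length vs) = 1"
      using ord nz order_mult[OF nz[unfolded char_poly_B], of l] unfolding char_poly_B by simp
    moreover have "order l range_poly \<noteq> 0" using that range_poly_degree(2) by (simp add: order_root)
    ultimately show ?thesis by simp
  qed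
  then have "rsquarefree range_poly"
    by (rule all_roots_simple_imp_rsquarefree[OF range_poly_degree(2)])
  then show "card (Spec B - {0}) = crank B"
    unfolding Spec_B_nonzero using rsquarefree_card_degree[OF range_poly_degree(2)]
    by (simp add: range_poly_degree(1) length_us)
  show "l \<in> Spec B - {0} \<Longrightarrow> poly (pderiv (char_poly (op_matrix UNIV B))) l \<noteq> 0"
    by (rule order_one_pderiv_nonzero[OF nz ord])
qed

abbreviation "trunc \<equiv> truncation (Ker B) A"

abbreviation trunc_poly :: "complex poly" where
  "trunc_poly \<equiv> char_poly (op_matrix (Ker B) trunc)"

lemma trunc_poly_degree: "degree trunc_poly = length vs" "trunc_poly \<noteq> 0"
proof -
  have "op_matrix (Ker B) trunc \<in> carrier_mat (length vs) (length vs)"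
    by (simp add: op_matrix_eq mat_rep_def)
  from degree_monic_char_poly[OF this]
  show "degree trunc_poly = length vs" "trunc_poly \<noteq> 0" by auto
qed

lemma spec_trunc_iff: "spec_on (Ker B) trunc = {l. poly trunc_poly l = 0}"
  unfolding op_matrix_eq
  using spec_on_iff_char_poly[OF is_basis_vs clinear_truncation]
    orth_proj_props(1)[OF fd subspace_Ker] by (auto simp: truncation_def)

lemma spec_trunc_real:
  assumes "l \<in> spec_on (Ker B) trunc"
  shows "Im l = 0"
proof (rule symmetric_spec_real[OF _ assms])
  have *: "cinner (trunc x) y = cinner (A x) y" if "x \<in> Ker B" "y \<in> Ker B" for x y
    using orth_proj_props(2)[OF fd subspace_Ker that(2), of "A x"]
      orth_proj_props(4)[OF fd subspace_Ker that(1)]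
    by (simp add: truncation_def cinner_diff_left)
  fix x y assume xy: "x \<in> Ker B" "y \<in> Ker B"
  have "cinner (trunc x) y = cinner x (A y)"
    using *[OF xy] A unfolding self_adjoint_def by simp
  also have "\<dots> = cinner x (trunc y)"
    using *[OF xy(2,1)] by (metis cinner_commute)
  finally show "cinner (trunc x) y = cinner x (trunc y)" .
qed

lemma simple_eigenvalues_trunc:
  assumes "\<forall>l \<in> spec_on (Ker B) trunc. alg_mult_on (Ker B) trunc l = 1"
  shows "card (spec_on (Ker B) trunc) = N - crank B"
    and "l \<in> spec_on (Ker B) trunc \<Longrightarrow> poly (pderiv trunc_poly) l \<noteq> 0"
proof -
  have "rsquarefree trunc_poly"
    by (rule all_roots_simple_imp_rsquarefree[OF trunc_poly_degree(2)])
      (use assms in \<open>auto simp: spec_trunc_iff alg_mult_on_def\<close>)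
  then show "card (spec_on (Ker B) trunc) = N - crank B"
    "l \<in> spec_on (Ker B) trunc \<Longrightarrow> poly (pderiv trunc_poly) l \<noteq> 0"
    unfolding spec_trunc_iff using rsquarefree_card_degree[OF trunc_poly_degree(2)]
      trunc_poly_degree(1) length_us length_us_vs rsquarefree_roots by auto
qed

text \<open>The determinant of \<open>B + \<epsilon> A - \<mu>\<close>. For \<open>\<epsilon> \<noteq> 0\<close> its zeros are
  \<open>\<mu> = \<epsilon> \<lambda>\<close> with \<open>p(1 / \<epsilon>, \<lambda>) = 0\<close>; it controls the eigenvalues that grow like \<open>1 / \<epsilon>\<close>.\<close>
definition large_pencil :: "complex \<Rightarrow> complex \<Rightarrow> complex" where
  "large_pencil \<epsilon> \<mu> = mdet (length us + length vs)
     (\<lambda>i j. \<epsilon> * A_entry i j + B_entry i j - (if i = j then \<mu> else 0))"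

text \<open>For \<open>\<epsilon> \<noteq> 0\<close> this is the determinant of \<open>A + (1 / \<epsilon>) B - \<lambda>\<close> with the rows that
  belong to the range of \<open>B\<close> multiplied by \<open>\<epsilon>\<close>, which clears the poles and leaves the zeros
  unchanged. It controls the eigenvalues that stay bounded as \<open>\<epsilon>\<close> tends to 0.\<close>
definition bounded_pencil :: "complex \<Rightarrow> complex \<Rightarrow> complex" where
  "bounded_pencil \<epsilon> l = mdet (length us + length vs)
     (\<lambda>i j. if i < length us then \<epsilon> * (A_entry i j - (if i = j then l else 0)) + B_entry i j
        else A_entry i j - (if i = j then l else 0))"

lemma large_pencil_jointly_C1: "jointly_C1 large_pencil"
  unfolding large_pencil_def[abs_def] by (intro jointly_C1_det jointly_C1_intros)

lemma bounded_pencil_jointly_C1: "jointly_C1 bounded_pencil"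
  unfolding bounded_pencil_def[abs_def] by (intro jointly_C1_det jointly_C1_intros)

lemma inverse_mult_entry:
  fixes \<gamma> :: complex
  assumes "\<gamma> \<noteq> 0"
  shows "inverse \<gamma> * (x + \<gamma> * y - z) = inverse \<gamma> * x + y - inverse \<gamma> * z"
  using assms by (simp add: distrib_left right_diff_distrib mult.assoc[symmetric])

lemma large_pencil_scaling:
  assumes "\<gamma> \<noteq> 0"
  shows "large_pencil (inverse \<gamma>) \<mu> = inverse \<gamma> ^ N * pencil_det A B \<gamma> (\<mu> * \<gamma>)"
proof -
  let ?f = "\<lambda>i j. A_entry i j + \<gamma> * B_entry i j - (if i = j then \<mu> * \<gamma> else 0)"
  have "large_pencil (inverse \<gamma>) \<mu> = mdet N (\<lambda>i j. if i < N then inverse \<gamma> * ?f i j else ?f i j)"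
    unfolding large_pencil_def length_us_vs
    by (rule mdet_cong) (use assms in \<open>simp add: inverse_mult_entry\<close>)
  also have "\<dots> = inverse \<gamma> ^ N * mdet N ?f" by (rule mdet_scale_rows) simp
  finally show ?thesis unfolding pencil_det_adapted length_us_vs .
qed

lemma bounded_pencil_scaling:
  assumes "\<gamma> \<noteq> 0"
  shows "bounded_pencil (inverse \<gamma>) l = inverse \<gamma> ^ length us * pencil_det A B \<gamma> l"
proof -
  let ?f = "\<lambda>i j. A_entry i j + \<gamma> * B_entry i j - (if i = j then l else 0)"
  have "bounded_pencil (inverse \<gamma>) l = mdet (length us + length vs)
      (\<lambda>i j. if i < length us then inverse \<gamma> * ?f i j else ?f i j)"
    unfolding bounded_pencil_def
  proof (rule mdet_cong)
    fix i j assume ij: "i < length us + length vs" "j < length us + length vs"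
    show "(if i < length us then inverse \<gamma> * (A_entry i j - (if i = j then l else 0)) + B_entry i j
        else A_entry i j - (if i = j then l else 0)) = (if i < length us then inverse \<gamma> * ?f i j else ?f i j)"
    proof (cases "i < length us")
      case True
      then show ?thesis
        unfolding inverse_mult_entry[OF assms] by (simp add: right_diff_distrib)
    next
      case False
      then have "B_entry i j = 0"
        using B_entry_low_row[of "i - length us" j] ij(1) by auto
      then show ?thesis using False by simp
    qed
  qed
  also have "\<dots> = inverse \<gamma> ^ length us * mdet (length us + length vs) ?f"
    by (rule mdet_scale_rows) simp
  finally show ?thesis unfolding pencil_det_adapted .
qed

lemma large_pencil_0: "large_pencil 0 \<mu> = (-1) ^ N * poly (char_poly (op_matrix UNIV B)) \<mu>"
  unfolding large_pencil_def char_poly_B by (simp add: mdet_full_B_entry_shift poly_power)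

text \<open>In the limit the rows of the range only contain the invertible block of \<open>B\<close>, so the matrix becomes
  block triangular and the bounded eigenvalues are those of the truncation.\<close>
lemma bounded_pencil_0:
  "bounded_pencil 0 l = mdet (length us) B_entry * (-1) ^ length vs * poly trunc_poly l"
proof -
  have "bounded_pencil 0 l = mdet (length us + length vs) (\<lambda>i j. if i < length us then B_entry i j
        else A_entry i j - (if i = j then l else 0))"
    unfolding bounded_pencil_def by (rule mdet_cong) simp
  also have "\<dots> = mdet (length us) (\<lambda>i j. if i < length us then B_entry i j else A_entry i j - (if i = j then l else 0)) *
      mdet (length vs) (\<lambda>i j. if length us + i < length us then B_entry (length us + i) (length us + j)
        else A_entry (length us + i) (length us + j) - (if length us + i = length us + j then l else 0))"
    by (rule mdet_block_upper_zero) (auto simp: B_entry_right_col)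
  also have "mdet (length us) (\<lambda>i j. if i < length us then B_entry i j else A_entry i j - (if i = j then l else 0)) =
      mdet (length us) B_entry"
    by (rule mdet_cong) auto
  also have "mdet (length vs) (\<lambda>i j. if length us + i < length us then B_entry (length us + i) (length us + j)
        else A_entry (length us + i) (length us + j) - (if length us + i = length us + j then l else 0)) =
      mdet (length vs) (\<lambda>i j. mat_rep vs vs trunc $$ (i, j) - (if i = j then l else 0))"
    by (rule mdet_cong) (auto simp: A_entry_block)
  also have "\<dots> = (-1) ^ length vs * poly trunc_poly l"
    unfolding op_matrix_eq by (rule mdet_shift_char_poly) (simp add: mat_rep_def)
  finally show ?thesis by simp
qed

lemma large_pencil_snd_partial:
  assumes "has_partials large_pencil p1 p2"
  shows "p2 0 \<mu> = (-1) ^ N * poly (pderiv (char_poly (op_matrix UNIV B))) \<mu>"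
proof -
  have "((\<lambda>\<mu>. large_pencil 0 \<mu>) has_field_derivative
      (-1) ^ N * poly (pderiv (char_poly (op_matrix UNIV B))) \<mu>) (at \<mu>)"
    unfolding large_pencil_0 by (intro DERIV_cmult poly_DERIV)
  then show ?thesis
    using has_partials_snd_deriv[OF assms] DERIV_unique by blast
qed

lemma bounded_pencil_snd_partial:
  assumes "has_partials bounded_pencil p1 p2"
  shows "p2 0 l = mdet (length us) B_entry * (-1) ^ length vs * poly (pderiv trunc_poly) l"
proof -
  have "((\<lambda>l. bounded_pencil 0 l) has_field_derivative
      mdet (length us) B_entry * (-1) ^ length vs * poly (pderiv trunc_poly) l) (at l)"
    unfolding bounded_pencil_0 by (intro DERIV_cmult poly_DERIV)
  then show ?thesis
    using has_partials_snd_deriv[OF assms] DERIV_unique by blast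
qed

end

section \<open>Asymptotics of the eigenvalue curves\<close>

lemma tendsto_at_0_continuous_ball:
  fixes \<phi> :: "complex \<Rightarrow> complex"
  assumes "r > 0" "continuous_on (ball 0 r) \<phi>" "(e \<longlongrightarrow> 0) F"
  shows "((\<lambda>t. \<phi> (e t)) \<longlongrightarrow> \<phi> 0) F"
proof -
  have "isCont \<phi> 0"
    using assms(1,2) by (simp add: continuous_on_eq_continuous_at)
  then show ?thesis by (rule isCont_tendsto_compose[OF _ assms(3)])
qed

context cyclic_pencil
begin

text \<open>The branches \<open>\<Psi>\<close> of zeros of \<open>large_pencil\<close> through the \<open>\<beta>\<close>s and \<open>\<Phi>\<close> of zeros of
  \<open>bounded_pencil\<close> through the \<open>\<delta>\<close>s, evaluated at \<open>\<epsilon> = 1 / g(t)\<close>, yield the functions \<open>h k\<close>.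
  For large times these are \<open>N\<close> distinct eigenvalues, hence all eigenvalues, and each given curve
  follows one of them.\<close>
lemma eigenvalue_asymptotics:
  fixes g :: "real \<Rightarrow> complex" and ev :: "nat \<Rightarrow> real \<Rightarrow> complex"
    and \<beta> :: "nat \<Rightarrow> complex" and \<delta> :: "nat \<Rightarrow> complex"
  assumes simple_B: "\<forall>l \<in> Spec B - {0}. alg_mult B l = 1"
    and simple_trunc: "\<forall>l \<in> spec_on (Ker B) trunc. alg_mult_on (Ker B) trunc l = 1"
    and \<beta>: "bij_betw \<beta> {..<crank B} (Spec B - {0})"
    and \<delta>: "bij_betw \<delta> {..<N - crank B} (spec_on (Ker B) trunc)"
    and g: "continuous_on {0..} g" "filterlim (\<lambda>t. norm (g t)) at_top at_top"
    and ev: "\<And>r. r < N \<Longrightarrow> continuous_on {0..} (ev r)"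
    and zeros: "\<And>t. t \<ge> 0 \<Longrightarrow> {l. pencil_det A B (g t) l = 0} = {ev r t | r. r < N}"
    and card: "\<And>t. t \<ge> 0 \<Longrightarrow> card {l. pencil_det A B (g t) l = 0} = N"
  shows "\<exists>p. p permutes {..<N} \<and>
    (\<forall>r<crank B. ((\<lambda>t. ev (p r) t / g t) \<longlongrightarrow> \<beta> r) at_top) \<and>
    (\<forall>r<N - crank B. (ev (p (crank B + r)) \<longlongrightarrow> \<delta> r) at_top)"
proof -
  define M where "M = crank B"
  define R where "R = Spec B - {0}"
  define \<Delta> where "\<Delta> = spec_on (Ker B) trunc"
  have MN: "M \<le> N" using length_us length_us_vs unfolding M_def by simp
  have finR: "finite R" unfolding R_def Spec_B_nonzero
    by (rule poly_roots_finite[OF range_poly_degree(2)])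
  have fin\<Delta>: "finite \<Delta>" unfolding \<Delta>_def spec_trunc_iff
    by (rule poly_roots_finite[OF trunc_poly_degree(2)])
  have \<beta>R: "\<beta> k \<in> R" if "k < M" for k
    using \<beta> that unfolding R_def M_def bij_betw_def by auto
  have \<delta>\<Delta>: "\<delta> k \<in> \<Delta>" if "k < N - M" for k
    using \<delta> that unfolding \<Delta>_def M_def bij_betw_def by auto
  have \<beta>_inj: "k = l" if "k < M" "l < M" "\<beta> k = \<beta> l" for k l
    using \<beta> that unfolding M_def bij_betw_def inj_on_def by auto
  have \<delta>_inj: "k = l" if "k < N - M" "l < N - M" "\<delta> k = \<delta> l" for k l
    using \<delta> that unfolding M_def bij_betw_def inj_on_def by auto
  obtain p1 p2 where p: "has_partials large_pencil p1 p2"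
    using large_pencil_jointly_C1 unfolding jointly_C1_def by blast
  obtain q1 q2 where q: "has_partials bounded_pencil q1 q2"
    using bounded_pencil_jointly_C1 unfolding jointly_C1_def by blast
  \<comment> \<open>Separating the \<open>\<beta>\<close>s from 0 as well keeps the values of \<open>\<Psi>\<close> away from 0, so the growing branches
  outgrow the bounded ones.\<close>
  obtain e where e: "e > 0" "\<And>b c. b \<in> insert 0 R \<Longrightarrow> c \<in> insert 0 R \<Longrightarrow> b \<noteq> c \<Longrightarrow> 2 * e \<le> dist b c"
    using finite_separation[of "insert 0 R"] finR by auto
  obtain d where d: "d > 0" "\<And>b c. b \<in> \<Delta> \<Longrightarrow> c \<in> \<Delta> \<Longrightarrow> b \<noteq> c \<Longrightarrow> 2 * d \<le> dist b c"
    using finite_separation[OF fin\<Delta>] by metis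
  have PR: "large_pencil 0 b = 0" "p2 0 b \<noteq> 0" if "b \<in> R" for b
  proof -
    have "poly range_poly b = 0" using that Spec_B_nonzero unfolding R_def by blast
    then show "large_pencil 0 b = 0" unfolding large_pencil_0 char_poly_B by simp
    show "p2 0 b \<noteq> 0"
      using simple_nonzero_eigenvalues_B(2)[OF simple_B] that
      unfolding large_pencil_snd_partial[OF p] R_def by simp
  qed
  have QR: "bounded_pencil 0 b = 0" "q2 0 b \<noteq> 0" if "b \<in> \<Delta>" for b
    using that simple_eigenvalues_trunc(2)[OF simple_trunc, of b] mdet_B_entry_nonzero
    unfolding bounded_pencil_0 bounded_pencil_snd_partial[OF q] \<Delta>_def
    by (auto simp: spec_trunc_iff)
  obtain rP \<Psi> where rP: "rP > 0" and \<Psi>: "\<And>b. b \<in> R \<Longrightarrow> \<Psi> b 0 = b"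
    "\<And>b. b \<in> R \<Longrightarrow> continuous_on (ball 0 rP) (\<Psi> b)"
    "\<And>b x. b \<in> R \<Longrightarrow> x \<in> ball 0 rP \<Longrightarrow> large_pencil x (\<Psi> b x) = 0"
    "\<And>b x. b \<in> R \<Longrightarrow> x \<in> ball 0 rP \<Longrightarrow> dist (\<Psi> b x) b < e"
    using zero_sheets[OF p finR PR e(1)] by metis
  obtain rQ \<Phi> where rQ: "rQ > 0" and \<Phi>: "\<And>b. b \<in> \<Delta> \<Longrightarrow> \<Phi> b 0 = b"
    "\<And>b. b \<in> \<Delta> \<Longrightarrow> continuous_on (ball 0 rQ) (\<Phi> b)"
    "\<And>b x. b \<in> \<Delta> \<Longrightarrow> x \<in> ball 0 rQ \<Longrightarrow> bounded_pencil x (\<Phi> b x) = 0"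
    "\<And>b x. b \<in> \<Delta> \<Longrightarrow> x \<in> ball 0 rQ \<Longrightarrow> dist (\<Phi> b x) b < d"
    using zero_sheets[OF q fin\<Delta> QR d(1)] by metis
  define C where "C = Max (insert 0 (norm ` \<Delta>)) + d"
  have C: "norm (\<Phi> b x) < C" if "b \<in> \<Delta>" "x \<in> ball 0 rQ" for b x
  proof -
    have "norm b \<le> Max (insert 0 (norm ` \<Delta>))"
      using that(1) fin\<Delta> by (intro Max_ge) auto
    moreover have "norm (\<Phi> b x) \<le> norm b + dist (\<Phi> b x) b"
      by (metis dist_norm norm_triangle_sub)
    ultimately show ?thesis using \<Phi>(4)[OF that] unfolding C_def by linarith
  qed
  \<comment> \<open>Beyond this bound \<open>1 / g(t)\<close> lies in the domains of all branches, and the growing branches exceed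
  the bound \<open>C\<close> of the others.\<close>
  define Z where "Z = Max {1, inverse rP, inverse rQ, C / e}"
  obtain T0 where T0: "\<And>t. t \<ge> T0 \<Longrightarrow> norm (g t) \<ge> Z + 1"
    using g(2) unfolding filterlim_at_top eventually_at_top_linorder by metis
  define T where "T = max T0 0"
  have Tpos: "T \<ge> 0" by (simp add: T_def)
  have big: "norm (g t) > 1" "norm (g t) > inverse rP" "norm (g t) > inverse rQ" "norm (g t) > C / e"
    if "t \<ge> T" for t
  proof -
    have "1 \<le> Z" "inverse rP \<le> Z" "inverse rQ \<le> Z" "C / e \<le> Z"
      by (auto simp: Z_def)
    then show "norm (g t) > 1" "norm (g t) > inverse rP" "norm (g t) > inverse rQ" "norm (g t) > C / e"
      using T0[of t] that by (auto simp: T_def)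
  qed
  have g0: "g t \<noteq> 0" if "t \<ge> T" for t using big(1)[OF that] by auto
  have small: "inverse (g t) \<in> ball 0 rP" "inverse (g t) \<in> ball 0 rQ" if "t \<ge> T" for t
    using less_imp_inverse_less[OF big(2)[OF that]] less_imp_inverse_less[OF big(3)[OF that]] rP rQ
    by (auto simp: norm_inverse)
  have cg: "continuous_on {T..} (\<lambda>t. inverse (g t))" "continuous_on {T..} g"
    using g(1) g0 Tpos by (auto intro!: continuous_intros intro: continuous_on_subset)
  define h where "h = (\<lambda>k t. if k < M then \<Psi> (\<beta> k) (inverse (g t)) * g t
    else \<Phi> (\<delta> (k - M)) (inverse (g t)))"
  have h_cont: "continuous_on {T..} (h k)" if k: "k < N" for k
  proof (cases "k < M")
    case True
    have "continuous_on {T..} (\<lambda>t. \<Psi> (\<beta> k) (inverse (g t)))"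
      by (rule continuous_on_compose2[OF \<Psi>(2)[OF \<beta>R[OF True]] cg(1)]) (use small in auto)
    then show ?thesis
      using True cg(2) by (simp add: h_def continuous_on_mult)
  next
    case False
    then have "k - M < N - M" using k MN by simp
    from \<Phi>(2)[OF \<delta>\<Delta>[OF this]]
    have "continuous_on {T..} (\<lambda>t. \<Phi> (\<delta> (k - M)) (inverse (g t)))"
      by (rule continuous_on_compose2[OF _ cg(1)]) (use small in auto)
    then show ?thesis using False by (simp add: h_def)
  qed
  have h_zero: "pencil_det A B (g t) (h k t) = 0" if k: "k < N" and t: "t \<ge> T" for k t
  proof (cases "k < M")
    case True
    show ?thesis
      using \<Psi>(3)[OF \<beta>R[OF True] small(1)[OF t]] True g0[OF t]
      unfolding large_pencil_scaling[OF g0[OF t]] by (simp add: h_def)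
  next
    case False
    then have "k - M < N - M" using k MN by simp
    then show ?thesis
      using \<Phi>(3)[OF \<delta>\<Delta> small(2)[OF t], of "k - M"] False g0[OF t]
      unfolding bounded_pencil_scaling[OF g0[OF t]] by (simp add: h_def)
  qed
  have large: "norm (h k t) > C" if k: "k < M" and t: "t \<ge> T" for k t
  proof -
    let ?z = "\<Psi> (\<beta> k) (inverse (g t))"
    have "dist ?z (\<beta> k) < e" by (rule \<Psi>(4)[OF \<beta>R[OF k] small(1)[OF t]])
    moreover have "2 * e \<le> norm (\<beta> k)"
      using e(2)[of "\<beta> k" 0] \<beta>R[OF k] unfolding R_def by auto
    ultimately have "e < norm ?z"
      using norm_triangle_sub[of "\<beta> k" ?z] by (simp add: dist_norm norm_minus_commute)
    moreover have "C < e * norm (g t)"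
      using big(4)[OF t] e(1) by (simp add: field_simps)
    ultimately show ?thesis
      using k big(1)[OF t] by (simp add: h_def norm_mult)
        (meson less_trans mult_strict_right_mono zero_less_norm_iff g0[OF t])
  qed
  have h_inj: "k = l" if t: "t \<ge> T" and k: "k < N" and l: "l < N" and eq: "h k t = h l t" for t k l
  proof -
    have small_h: "norm (h j t) < C" if "j < N" "\<not> j < M" for j
      using C[OF \<delta>\<Delta> small(2)[OF t], of "j - M"] that MN by (simp add: h_def)
    consider "k < M" "l < M" | "\<not> k < M" "\<not> l < M" | "k < M" "\<not> l < M" | "\<not> k < M" "l < M"
      by blast
    then show ?thesis
    proof cases
      case 1
      then have eq': "\<Psi> (\<beta> k) (inverse (g t)) = \<Psi> (\<beta> l) (inverse (g t))"
        using eq g0[OF t] by (simp add: h_def)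
      have "dist (\<beta> k) (\<beta> l) < 2 * e"
        using \<Psi>(4)[OF \<beta>R[OF 1(1)] small(1)[OF t]] \<Psi>(4)[OF \<beta>R[OF 1(2)] small(1)[OF t]]
          dist_triangle3[of "\<beta> k" "\<beta> l" "\<Psi> (\<beta> k) (inverse (g t))"] unfolding eq' by simp
      then have "\<beta> k = \<beta> l" using e(2)[of "\<beta> k" "\<beta> l"] \<beta>R 1 by fastforce
      then show ?thesis using \<beta>_inj 1 by blast
    next
      case 2
      have kl: "k - M < N - M" "l - M < N - M" using 2 k l MN by auto
      have eq': "\<Phi> (\<delta> (k - M)) (inverse (g t)) = \<Phi> (\<delta> (l - M)) (inverse (g t))"
        using eq 2 by (simp add: h_def)
      have "dist (\<delta> (k - M)) (\<delta> (l - M)) < 2 * d"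
        using \<Phi>(4)[OF \<delta>\<Delta>[OF kl(1)] small(2)[OF t]] \<Phi>(4)[OF \<delta>\<Delta>[OF kl(2)] small(2)[OF t]]
          dist_triangle3[of "\<delta> (k - M)" "\<delta> (l - M)" "\<Phi> (\<delta> (k - M)) (inverse (g t))"]
        unfolding eq' by simp
      then have "\<delta> (k - M) = \<delta> (l - M)"
        using d(2)[of "\<delta> (k - M)" "\<delta> (l - M)"] \<delta>\<Delta> kl by fastforce
      then have "k - M = l - M" using \<delta>_inj kl by blast
      then show ?thesis using 2 by simp
    next
      case 3
      then show ?thesis using large[OF 3(1) t] small_h[OF l 3(2)] eq by simp
    next
      case 4
      then show ?thesis using large[OF 4(2) t] small_h[OF k 4(1)] eq by simp
    qed
  qed
  have h_cover: "\<exists>k\<in>{..<N}. ev r t = h k t" if r: "r < N" and t: "t \<ge> T" for r t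
  proof -
    have "(\<lambda>k. h k t) ` {..<N} = {l. pencil_det A B (g t) l = 0}"
    proof (rule card_seteq[OF finite_zeros])
      show "(\<lambda>k. h k t) ` {..<N} \<subseteq> {l. pencil_det A B (g t) l = 0}" using h_zero[OF _ t] by auto
      have "inj_on (\<lambda>k. h k t) {..<N}" using h_inj[OF t] by (intro inj_onI) auto
      then show "card {l. pencil_det A B (g t) l = 0} \<le> card ((\<lambda>k. h k t) ` {..<N})"
        using card_zeros_le by (simp add: card_image)
    qed
    moreover have "ev r t \<in> {l. pencil_det A B (g t) l = 0}"
      using zeros[of t] r t Tpos by auto
    ultimately have "ev r t \<in> (\<lambda>k. h k t) ` {..<N}" by simp
    then show ?thesis by blast
  qed
  have "\<exists>k\<in>{..<N}. \<forall>t\<in>{T..}. ev r t = h k t" if r: "r < N" for r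
  proof -
    have c: "continuous_on {T..} (ev r)"
      using ev[OF r] Tpos by (auto intro: continuous_on_subset)
    obtain k where "k \<in> {..<N}" "\<And>t. t \<in> {T..} \<Longrightarrow> ev r t = h k t"
      by (rule branch_constant_on_connected[of "{T..}" "{..<N}" "ev r" h])
        (use c h_cont h_cover[OF r] h_inj in \<open>auto simp: convex_connected convex_real_interval\<close>)
    then show ?thesis by blast
  qed
  then obtain \<kappa> where \<kappa>: "\<And>r. r < N \<Longrightarrow> \<kappa> r < N" "\<And>r t. r < N \<Longrightarrow> t \<ge> T \<Longrightarrow> ev r t = h (\<kappa> r) t"
    by (metis atLeast_iff lessThan_iff)
  have "inj_on \<kappa> {..<N}"
  proof (rule inj_onI)
    fix r s assume rs: "r \<in> {..<N}" "s \<in> {..<N}" "\<kappa> r = \<kappa> s"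
    have "{l. pencil_det A B (g T) l = 0} = (\<lambda>r. ev r T) ` {..<N}"
      using zeros[OF Tpos] by auto
    then have "inj_on (\<lambda>r. ev r T) {..<N}"
      using card[OF Tpos] by (intro eq_card_imp_inj_on) auto
    moreover have "ev r T = ev s T" using \<kappa>(2) rs by simp
    ultimately show "r = s" using rs by (auto dest: inj_onD)
  qed
  then have bij: "bij_betw \<kappa> {..<N} {..<N}"
    using \<kappa>(1) by (intro bij_betw_imageI endo_inj_surj) auto
  \<comment> \<open>\<open>\<kappa>\<close> sends a curve to its branch; the required permutation sends a branch to its curve.\<close>
  define p where "p = (\<lambda>k. if k < N then inv_into {..<N} \<kappa> k else k)"
  have "bij_betw (inv_into {..<N} \<kappa>) {..<N} {..<N}" by (rule bij_betw_inv_into[OF bij])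
  then have "bij_betw p {..<N} {..<N}"
    by (subst bij_betw_cong[of _ _ "inv_into {..<N} \<kappa>"]) (auto simp: p_def)
  then have perm: "p permutes {..<N}"
    by (rule bij_imp_permutes) (simp add: p_def)
  have ev_p: "ev (p k) t = h k t" if "k < N" "t \<ge> T" for k t
  proof -
    have "p k < N" using permutes_in_image[OF perm, of k] that by simp
    moreover have "\<kappa> (p k) = k"
      using that bij_betw_inv_into_right[OF bij, of k] by (simp add: p_def)
    ultimately show ?thesis using \<kappa>(2)[of "p k" t] that by simp
  qed
  have "filterlim g at_infinity at_top"
    using g(2) by (simp add: filterlim_at_infinity_conv_norm_at_top)
  then have lim0: "((\<lambda>t. inverse (g t)) \<longlongrightarrow> 0) at_top"
    by (rule filterlim_compose[OF tendsto_inverse_0])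
  have evT: "eventually (\<lambda>t. t \<ge> T) at_top" by (rule eventually_ge_at_top)
  show ?thesis
  proof (intro exI[of _ p] conjI allI impI perm)
    fix r assume "r < crank B"
    then have r: "r < M" "r < N" using MN by (auto simp: M_def)
    have "((\<lambda>t. \<Psi> (\<beta> r) (inverse (g t))) \<longlongrightarrow> \<beta> r) at_top"
      using tendsto_at_0_continuous_ball[OF rP \<Psi>(2)[OF \<beta>R[OF r(1)]] lim0] \<Psi>(1)[OF \<beta>R[OF r(1)]]
      by simp
    moreover have "eventually (\<lambda>t. \<Psi> (\<beta> r) (inverse (g t)) = ev (p r) t / g t) at_top"
      using evT by eventually_elim (use ev_p[OF r(2)] g0 r in \<open>auto simp: h_def\<close>)
    ultimately show "((\<lambda>t. ev (p r) t / g t) \<longlongrightarrow> \<beta> r) at_top"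
      by (rule Lim_transform_eventually)
  next
    fix r assume "r < N - crank B"
    then have r: "r < N - M" "M + r < N" by (auto simp: M_def)
    have "((\<lambda>t. \<Phi> (\<delta> r) (inverse (g t))) \<longlongrightarrow> \<delta> r) at_top"
      using tendsto_at_0_continuous_ball[OF rQ \<Phi>(2)[OF \<delta>\<Delta>[OF r(1)]] lim0] \<Phi>(1)[OF \<delta>\<Delta>[OF r(1)]]
      by simp
    moreover have "eventually (\<lambda>t. \<Phi> (\<delta> r) (inverse (g t)) = ev (p (crank B + r)) t) at_top"
      using evT by eventually_elim (use ev_p[OF r(2)] in \<open>auto simp: h_def M_def\<close>)
    ultimately show "(ev (p (crank B + r)) \<longlongrightarrow> \<delta> r) at_top"
      by (rule Lim_transform_eventually)
  qed
qed

end

theorem theorem19: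
  fixes A B :: "'h::complex_inner_space \<Rightarrow> 'h"
    and \<sigma>\<^sub>1 \<sigma>\<^sub>2 :: real
    and N M :: nat
    and g :: "real \<Rightarrow> complex"
    and \<beta> :: "complex list"
  assumes finite_dim: "\<exists>S :: 'h set. finite S \<and> cvec.span S = UNIV"
    and dim_H: "cvec.dim (UNIV :: 'h set) = N"
    and A: "self_adjoint A"
    and B: "sectorial B \<sigma>\<^sub>1 \<sigma>\<^sub>2"
    and M: "M = crank B"
    and cyclic: "cyclic_for B A"
    and simple_A: "\<forall>l \<in> Spec A. alg_mult A l = 1"
    and simple_B: "\<forall>l \<in> Spec B - {0}. alg_mult B l = 1"
    and simple_trunc: "\<forall>l \<in> spec_on (Ker B) (truncation (Ker B) A).
          alg_mult_on (Ker B) (truncation (Ker B) A) l = 1"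
    and g_C1: "C1_curve g"
    and g_0: "g 0 = 0"
    and g_sector: "\<forall>t>0. g t \<in> sector \<sigma>\<^sub>1 \<sigma>\<^sub>2 - exceptional A B \<sigma>\<^sub>1 \<sigma>\<^sub>2 \<and> g t \<noteq> 0"
    and g_deriv: "\<forall>t\<ge>0. curve_deriv g t \<noteq> 0"
    and g_lim: "filterlim (\<lambda>t. norm (g t)) at_top at_top"
    and \<beta>_enum: "distinct \<beta>" "set \<beta> = Spec B - {0}"
  defines "\<alpha> \<equiv> eigenvalues_increasing UNIV A"
    and "\<delta> \<equiv> eigenvalues_increasing (Ker B) (truncation (Ker B) A)"
  shows "(\<exists>ev. eigenvalue_curves A B g N ev \<and> (\<forall>r<N. ev r 0 = complex_of_real (\<alpha> ! r)))
    \<and> (\<forall>ev. eigenvalue_curves A B g N ev \<and> (\<forall>r<N. ev r 0 = complex_of_real (\<alpha> ! r)) \<longrightarrow>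
          (\<exists>p. p permutes {..<N} \<and>
             (\<forall>r<M. ((\<lambda>t. ev (p r) t / g t) \<longlongrightarrow> \<beta> ! r) at_top) \<and>
             (\<forall>r<N - M. (ev (p (M + r)) \<longlongrightarrow> complex_of_real (\<delta> ! r)) at_top)))
    \<and> (real_analytic_curve g \<longrightarrow>
          (\<forall>ev. eigenvalue_curves A B g N ev \<longrightarrow> (\<forall>r<N. real_analytic_curve (ev r))))"
proof -
  interpret cyclic_pencil A B \<sigma>\<^sub>1 \<sigma>\<^sub>2 N
    by unfold_locales (rule finite_dim dim_H A B cyclic)+
  obtain p1 p2 where p: "has_partials (pencil_det A B) p1 p2"
    using pencil_jointly_C1 unfolding jointly_C1_def by blast
  note g_cont = C1_curve_continuous[OF g_C1]
  have g_pos: "g t \<in> sector \<sigma>\<^sub>1 \<sigma>\<^sub>2" "g t \<notin> exceptional1 A B \<sigma>\<^sub>1 \<sigma>\<^sub>2"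
    "g t \<notin> exceptional2 A B \<sigma>\<^sub>1 \<sigma>\<^sub>2" "g t \<noteq> 0" if "t > 0" for t
    using g_sector that unfolding exceptional_def by auto
  have card: "card {l. pencil_det A B (g t) l = 0} = N" if "t \<ge> 0" for t
    using that zeros_simple_at_0[OF simple_A] g_0 zeros_simple_not_exceptional1[OF g_pos(1,2)]
    by (cases "t = 0") auto
  have p2_nz: "p2 (g t) l \<noteq> 0" if "t \<ge> 0" "pencil_det A B (g t) l = 0" for t l
    by (rule pencil_snd_partial_nonzero[OF p card[OF that(1)] that(2)])
  \<comment> \<open>At \<open>t = 0\<close> the zeros are real, while \<open>exceptional2\<close> only concerns zeros in the open upper
  half-plane.\<close>
  have p1_nz: "p1 (g t) l \<noteq> 0" if t: "t \<ge> 0" and l: "pencil_det A B (g t) l = 0" for t l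
  proof (cases "t = 0")
    case True
    then show ?thesis
      using pencil_fst_partial_nonzero_at_0[OF p, of l] l p2_nz[OF t l] g_0 by simp
  next
    case False
    then show ?thesis
      using pencil_fst_partial_nonzero[OF p _ _ _ l] g_pos[of t] t by auto
  qed
  have SpecA: "Spec A = {l. pencil_det A B (g 0) l = 0}"
    using Spec_eq_zeros[of 0] g_0 by (simp add: perturbed_0)
  have \<alpha>: "bij_betw (\<lambda>r. complex_of_real (\<alpha> ! r)) {..<N} (Spec A)"
    using eigenvalues_increasing_bij[of UNIV A] finite_zeros card[of 0] symmetric_spec_real[of UNIV A] A
    unfolding \<alpha>_def SpecA self_adjoint_def by auto
  have fin_trunc: "finite (spec_on (Ker B) trunc)"
    unfolding spec_trunc_iff by (rule poly_roots_finite[OF trunc_poly_degree(2)])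
  have \<delta>: "bij_betw (\<lambda>r. complex_of_real (\<delta> ! r)) {..<N - crank B} (spec_on (Ker B) trunc)"
    using eigenvalues_increasing_bij[OF fin_trunc spec_trunc_real]
    unfolding \<delta>_def simple_eigenvalues_trunc(1)[OF simple_trunc] by simp
  have "length \<beta> = crank B"
    using distinct_card[OF \<beta>_enum(1)] \<beta>_enum(2) simple_nonzero_eigenvalues_B(1)[OF simple_B] by simp
  then have \<beta>: "bij_betw ((!) \<beta>) {..<crank B} (Spec B - {0})"
    using \<beta>_enum by (intro bij_betw_nth) auto
  have curvesD: "\<And>r. r < N \<Longrightarrow> continuous_on {0..} (ev r)"
    "\<And>t. t \<ge> 0 \<Longrightarrow> {l. pencil_det A B (g t) l = 0} = {ev r t | r. r < N}"
    if "eigenvalue_curves A B g N ev" for ev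
    using that C1_curve_continuous unfolding eigenvalue_curves_def Spec_eq_zeros by auto
  show ?thesis
  proof (intro conjI allI impI)
    obtain ev where ev: "\<And>r. r < N \<Longrightarrow> continuous_on {0..} (ev r)"
      "\<And>r. r < N \<Longrightarrow> ev r 0 = complex_of_real (\<alpha> ! r)"
      "\<And>t. t \<ge> 0 \<Longrightarrow> {l. pencil_det A B (g t) l = 0} = {ev r t | r. r < N}"
    proof (rule continuous_zero_curves[OF p finite_zeros card_zeros_le _ g_cont _ \<alpha>[unfolded SpecA]])
      show "p2 x y \<noteq> 0" if "card {l. pencil_det A B x l = 0} = N" "pencil_det A B x y = 0" for x y
        by (rule pencil_snd_partial_nonzero[OF p that])
      show "card {l. pencil_det A B (g t) l = 0} = N" if "t \<ge> 0" for t
        by (rule card[OF that])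
    qed (rule that)
    have zero: "pencil_det A B (g t) (ev r t) = 0" if "r < N" "t \<ge> 0" for r t
      using ev(3)[OF that(2)] that(1) by blast
    have "eigenvalue_curves A B g N ev"
      unfolding eigenvalue_curves_def Spec_eq_zeros
    proof (intro conjI allI impI)
      fix r assume r: "r < N"
      note z = zero[OF r]
      have f2: "p2 (g t) (ev r t) \<noteq> 0" if "t \<ge> 0" for t
        by (rule p2_nz[OF that z[OF that]])
      show "C1_curve (ev r)"
        by (rule root_curve_C1(1)[OF p _ g_C1 ev(1)[OF r]]) (use f2 z in auto)
      show "Im (ev r t) > 0" if "t > 0" for t
        using perturbed_spec_upper_half_plane[OF A B cyclic g_pos(1,4)[OF that]] z[of t] that
        unfolding Spec_eq_zeros by simp
      show "curve_deriv (ev r) t \<noteq> 0" if "t \<ge> 0" for t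
      proof -
        have "curve_deriv (ev r) t = - (p1 (g t) (ev r t) / p2 (g t) (ev r t)) * curve_deriv g t"
          by (rule root_curve_C1(2)[OF p _ g_C1 ev(1)[OF r]]) (use f2 z that in auto)
        then show ?thesis
          using p1_nz[OF that z[OF that]] f2[OF that] g_deriv that by simp
      qed
    qed (rule ev(3))
    then show "\<exists>ev. eigenvalue_curves A B g N ev \<and> (\<forall>r<N. ev r 0 = complex_of_real (\<alpha> ! r))"
      using ev(2) by blast
  next
    fix ev assume "eigenvalue_curves A B g N ev \<and> (\<forall>r<N. ev r 0 = complex_of_real (\<alpha> ! r))"
    then show "\<exists>p. p permutes {..<N} \<and>
        (\<forall>r<M. ((\<lambda>t. ev (p r) t / g t) \<longlongrightarrow> \<beta> ! r) at_top) \<and>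
        (\<forall>r<N - M. (ev (p (M + r)) \<longlongrightarrow> complex_of_real (\<delta> ! r)) at_top)"
      unfolding M using curvesD[of ev]
      by (intro eigenvalue_asymptotics[OF simple_B simple_trunc \<beta> \<delta> g_cont g_lim _ _ card]) auto
  next
    fix ev r assume ana: "real_analytic_curve g" and ev: "eigenvalue_curves A B g N ev" and r: "r < N"
    have z: "pencil_det A B (g t) (ev r t) = 0" if "t \<ge> 0" for t
      using curvesD(2)[OF ev that] r by blast
    show "real_analytic_curve (ev r)"
      by (rule root_curve_real_analytic[OF p _ g_cont curvesD(1)[OF ev r] _ ana]) (use p2_nz z in auto)
  qed
qed

end
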